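(* Let $H\in(0,1]$ and let $G:\mathbb{R}\to\mathbb{R}$ be a bounded measurable function. Then \[ E\,G(\zeta_H)=\int_{-\infty}^{\infty} E\big[G(\zeta_H-t)\,q_t\big]\,dt . \]
   Context: Let $W^H=\{W^H_s,\ s\in\mathbb{R}\}$ be a two-sided fractional Brownian motion with Hurst parameter $H\in(0,1]$: a centered Gaussian process with continuous trajectories, $W^H_0=0$, and $E|W^H_s-W^H_t|^2=|s-t|^{2H}$ for all $s,t\in\mathbb{R}$. Define $Z_t=\exp\{W^H_t-\tfrac12|t|^{2H}\}$, $q_t=Z_t\left(\int_{-\infty}^{\infty}Z_u\,du\right)^{-1}$ for $t\in\mathbb{R}$, and $\zeta_H=\int_{-\infty}^{\infty} t\,q_t\,dt$. *)

theory Defs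
  imports "HOL-Probability.Probability"
begin

definition centered_gaussian_rv :: "'a measure \<Rightarrow> ('a \<Rightarrow> real) \<Rightarrow> bool" where
  "centered_gaussian_rv M X \<longleftrightarrow>
     X \<in> borel_measurable M \<and>
     integrable M (\<lambda>\<omega>. (X \<omega>)^2) \<and>
     (\<forall>u::real. char (distr M borel X) u =
        complex_of_real (exp (- (u^2 * (\<integral>\<omega>. (X \<omega>)^2 \<partial>M)) / 2)))"

definition centered_gaussian_process :: "'a measure \<Rightarrow> (real \<Rightarrow> 'a \<Rightarrow> real) \<Rightarrow> bool" where
  "centered_gaussian_process M W \<longleftrightarrow>
     (\<forall>(F::real set) (c::real \<Rightarrow> real). finite F \<longrightarrow>
        centered_gaussian_rv M (\<lambda>\<omega>. \<Sum>t\<in>F. c t * W t \<omega>))"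

definition two_sided_fbm :: "'a measure \<Rightarrow> real \<Rightarrow> (real \<Rightarrow> 'a \<Rightarrow> real) \<Rightarrow> bool" where
  "two_sided_fbm M H W \<longleftrightarrow>
     centered_gaussian_process M W \<and>
     (\<forall>\<omega>\<in>space M. continuous_on UNIV (\<lambda>t. W t \<omega>)) \<and>
     (\<forall>\<omega>\<in>space M. W 0 \<omega> = 0) \<and>
     (\<forall>s t. (\<integral>\<omega>. (W s \<omega> - W t \<omega>)^2 \<partial>M) = \<bar>s - t\<bar> powr (2 * H))"

definition fbm_Z :: "real \<Rightarrow> (real \<Rightarrow> 'a \<Rightarrow> real) \<Rightarrow> real \<Rightarrow> 'a \<Rightarrow> real" where
  "fbm_Z H W t \<omega> = exp (W t \<omega> - \<bar>t\<bar> powr (2 * H) / 2)"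

definition fbm_q :: "real \<Rightarrow> (real \<Rightarrow> 'a \<Rightarrow> real) \<Rightarrow> real \<Rightarrow> 'a \<Rightarrow> real" where
  "fbm_q H W t \<omega> = fbm_Z H W t \<omega> / (\<integral>u. fbm_Z H W u \<omega> \<partial>lborel)"

definition fbm_zeta :: "real \<Rightarrow> (real \<Rightarrow> 'a \<Rightarrow> real) \<Rightarrow> 'a \<Rightarrow> real" where
  "fbm_zeta H W \<omega> = (\<integral>t. t * fbm_q H W t \<omega> \<partial>lborel)"

end

theory Submission
  imports Defs "HOL-Real_Asymp.Real_Asymp"
begin

text \<open>
  Under the probability measure with density \<open>Z t\<close> the process \<open>s \<mapsto> Z (t + s) / Z t\<close> has the law
  that \<open>Z\<close> has under \<open>M\<close> (Cameron--Martin and stationarity of increments). Applied to the functional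
  \<open>G \<zeta> * q (- t)\<close> of the path this yields \<open>E (G (\<zeta> - t) * q t) = E (G \<zeta> * q (- t))\<close>, and the theorem
  follows by integrating over \<open>t\<close>, since \<open>q\<close> almost surely has integral \<open>1\<close>. The equality of laws is
  read off from characteristic functions. That \<open>\<integral> (1 + \<bar>t\<bar>) * Z t\<close> is almost surely finite has to be
  proved as well: otherwise the division and the integrals take junk values.
\<close>

section \<open>Uniqueness of characteristic functions\<close>

text \<open>The exchange of expectations rests on an exact cancellation. Recentring at
  \<open>t\<close> turns \<open>q (- t)\<close> into \<open>q 0\<close>, and
  \<open>Z t * q 0 = q t\<close> because \<open>Z 0 = 1\<close>, so the density is absorbed without
  remainder. The functional to be transported depends on the whole path through quotients of
  integrals, so the identity of laws has to hold on the product space of paths. The Gaussian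
  hypothesis, however, only controls characteristic functions of finite linear combinations, and
  Levy uniqueness speaks about the line. This gap is the reason for the weighted one-dimensional
  uniqueness statements, which serve twice: to pass to several coordinates, and to separate a
  Gaussian variable from an uncorrelated one without joint densities. Finiteness of the integral of
  \<open>Z\<close> cannot be obtained by taking its mean, since every \<open>Z t\<close> has mean
  one; the square roots of \<open>Z\<close> at integer times do decay in mean.\<close>

lemma finite_measure_eqI_char:
  fixes M N :: "real measure"
  assumes M: "finite_measure M" "sets M = sets borel"
    and N: "finite_measure N" "sets N = sets borel"
    and eq: "\<And>s. char M s = char N s"
  shows "M = N"
proof -
  interpret M: finite_measure M by fact
  interpret N: finite_measure N by fact
  have sp: "space M = UNIV" "space N = UNIV"
    using M(2) N(2) sets_eq_imp_space_eq[of M borel] sets_eq_imp_space_eq[of N borel] by auto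
  have "complex_of_real (measure M (space M)) = complex_of_real (measure N (space N))"
    using eq[of 0] by (simp add: char_def scaleR_conv_of_real)
  then have mass: "measure M (space M) = measure N (space N)"
    by (simp only: of_real_eq_iff)
  define m where "m = measure M (space M)"
  show ?thesis
  proof (cases "m = 0")
    case True
    have "emeasure M A = 0" "emeasure N A = 0" if "A \<in> sets borel" for A
      using that True mass emeasure_space[of M A] emeasure_space[of N A]
      by (simp_all add: m_def M.emeasure_eq_measure N.emeasure_eq_measure)
    then show ?thesis using M(2) N(2) by (intro measure_eqI) auto
  next
    case False
    then have m: "m > 0" by (simp add: m_def zero_less_measure_iff)
    \<comment> \<open>Levy uniqueness concerns probability laws, so both measures are divided by
      their common mass, which is the value of either characteristic function at 0.\<close>
    let ?M = "density M (\<lambda>_. ennreal (1 / m))" and ?N = "density N (\<lambda>_. ennreal (1 / m))"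
    have one: "ennreal (1/m) * ennreal m = 1"
      using m by (simp add: ennreal_mult[symmetric])
    have "real_distribution ?M"
      using one M(2) sp by (auto simp: real_distribution_def real_distribution_axioms_def
          emeasure_density m_def M.emeasure_eq_measure intro!: prob_spaceI)
    moreover have "real_distribution ?N"
      using one N(2) sp mass by (auto simp: real_distribution_def real_distribution_axioms_def
          emeasure_density m_def N.emeasure_eq_measure intro!: prob_spaceI)
    moreover have "char ?M = char ?N"
    proof
      fix s
      have [measurable]: "(\<lambda>x::real. iexp (s * x)) \<in> borel_measurable M"
        "(\<lambda>x::real. iexp (s * x)) \<in> borel_measurable N"
        unfolding measurable_cong_sets[OF M(2) refl] measurable_cong_sets[OF N(2) refl]
        by measurable
      show "char ?M s = char ?N s"
        using eq[of s] m by (simp add: char_def integral_density del: of_real_mult)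
    qed
    ultimately have MN: "?M = ?N" by (rule Levy_uniqueness)
    have "emeasure M A = emeasure N A" if A: "A \<in> sets borel" for A
    proof -
      have "ennreal (1/m) * emeasure M A = ennreal (1/m) * emeasure N A"
        using arg_cong[OF MN, of "\<lambda>P. emeasure P A"] A M(2) N(2)
        by (simp add: emeasure_density nn_integral_cmult)
      then have "ennreal m * (ennreal (1/m) * emeasure M A) = ennreal m * (ennreal (1/m) * emeasure N A)"
        by simp
      then show ?thesis using one by (simp add: mult.assoc[symmetric] mult.commute[of "ennreal m"])
    qed
    then show ?thesis using M(2) N(2) by (intro measure_eqI) auto
  qed
qed

text \<open>Bounded nonnegative weights are densities of finite measures. Hypothesis
  \<open>eq\<close> says that the images of these measures under \<open>X\<close> and
  \<open>Y\<close> have the same characteristic function, so the images coincide and integrate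
  \<open>f\<close> alike.\<close>

lemma weighted_expectation_eqI_char_nonneg:
  fixes X :: "'a \<Rightarrow> real" and Y :: "'b \<Rightarrow> real" and f :: "real \<Rightarrow> complex"
  assumes M: "finite_measure M" and N: "finite_measure N"
    and [measurable]: "X \<in> borel_measurable M" "Y \<in> borel_measurable N" "f \<in> borel_measurable borel"
      "w \<in> borel_measurable M" "v \<in> borel_measurable N"
    and w: "\<And>x. 0 \<le> w x" "\<And>x. w x \<le> (B::real)" and v: "\<And>x. 0 \<le> v x" "\<And>x. v x \<le> B"
    and eq: "\<And>s. (\<integral>x. w x *\<^sub>R iexp (s * X x) \<partial>M) = (\<integral>x. v x *\<^sub>R iexp (s * Y x) \<partial>N)"
  shows "(\<integral>x. w x *\<^sub>R f (X x) \<partial>M) = (\<integral>x. v x *\<^sub>R f (Y x) \<partial>N)"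
proof -
  interpret M: finite_measure M by fact
  interpret N: finite_measure N by fact
  let ?M = "density M (\<lambda>x. ennreal (w x))" and ?N = "density N (\<lambda>x. ennreal (v x))"
  have "integrable M w" "integrable N v"
    using w v by (auto intro!: M.integrable_const_bound[where B=B] N.integrable_const_bound[where B=B])
  then have "finite_measure ?M" "finite_measure ?N"
    using w v by (auto intro!: finite_measureI simp: emeasure_density nn_integral_eq_integral cong: nn_integral_cong)
  then have fin: "finite_measure (distr ?M borel X)" "finite_measure (distr ?N borel Y)"
    by (auto intro!: finite_measure.finite_measure_distr)
  have "distr ?M borel X = distr ?N borel Y"
    by (rule finite_measure_eqI_char) (use w v eq fin in \<open>simp_all add: char_def integral_distr integral_density\<close>)
  then have "(\<integral>x. f x \<partial>distr ?M borel X) = (\<integral>x. f x \<partial>distr ?N borel Y)" by simp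
  then show ?thesis using w v by (simp add: integral_distr integral_density)
qed

text \<open>The shifted weights \<open>B + w\<close> and \<open>B + v\<close> lie between 0 and
  \<open>2 * B\<close>. By \<open>eq1\<close> the added constant contributes equally to both
  characteristic functions, and integrability of \<open>f\<close> allows its contribution to be
  split off again at the end.\<close>

lemma weighted_expectation_eqI_char_real:
  fixes X :: "'a \<Rightarrow> real" and Y :: "'b \<Rightarrow> real" and f :: "real \<Rightarrow> complex"
  assumes M: "finite_measure M" and N: "finite_measure N"
    and [measurable]: "X \<in> borel_measurable M" "Y \<in> borel_measurable N" "f \<in> borel_measurable borel"
      "w \<in> borel_measurable M" "v \<in> borel_measurable N"
    and w: "\<And>x. \<bar>w x\<bar> \<le> (B::real)" and v: "\<And>x. \<bar>v x\<bar> \<le> B"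
    and f: "integrable M (\<lambda>x. f (X x))" "integrable N (\<lambda>x. f (Y x))"
    and eq1: "\<And>s. (\<integral>x. iexp (s * X x) \<partial>M) = (\<integral>x. iexp (s * Y x) \<partial>N)"
    and eq: "\<And>s. (\<integral>x. w x *\<^sub>R iexp (s * X x) \<partial>M) = (\<integral>x. v x *\<^sub>R iexp (s * Y x) \<partial>N)"
  shows "(\<integral>x. w x *\<^sub>R f (X x) \<partial>M) = (\<integral>x. v x *\<^sub>R f (Y x) \<partial>N)"
proof -
  interpret M: finite_measure M by fact
  interpret N: finite_measure N by fact
  have B: "0 \<le> B" using w[of undefined] by linarith
  have iw: "integrable M (\<lambda>x. w x *\<^sub>R g x)" if "integrable M g" for g :: "'a \<Rightarrow> complex"
    by (rule Bochner_Integration.integrable_bound[of _ "\<lambda>x. B * norm (g x)"])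
      (use that w B in \<open>auto intro!: AE_I2 mult_mono order_trans[OF _ abs_ge_self]\<close>)
  have iv: "integrable N (\<lambda>x. v x *\<^sub>R g x)" if "integrable N g" for g :: "'b \<Rightarrow> complex"
    by (rule Bochner_Integration.integrable_bound[of _ "\<lambda>x. B * norm (g x)"])
      (use that v B in \<open>auto intro!: AE_I2 mult_mono order_trans[OF _ abs_ge_self]\<close>)
  have split: "(\<integral>x. (B + w x) *\<^sub>R g x \<partial>M) = B *\<^sub>R (\<integral>x. g x \<partial>M) + (\<integral>x. w x *\<^sub>R g x \<partial>M)"
    if "integrable M g" for g :: "'a \<Rightarrow> complex"
    using that iw[OF that] by (simp add: scaleR_left_distrib)
  have split': "(\<integral>x. (B + v x) *\<^sub>R g x \<partial>N) = B *\<^sub>R (\<integral>x. g x \<partial>N) + (\<integral>x. v x *\<^sub>R g x \<partial>N)"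
    if "integrable N g" for g :: "'b \<Rightarrow> complex"
    using that iv[OF that] by (simp add: scaleR_left_distrib)
  have ie: "integrable M (\<lambda>x. iexp (s * X x))" "integrable N (\<lambda>x. iexp (s * Y x))" for s
    by (auto intro!: M.integrable_const_bound[where B=1] N.integrable_const_bound[where B=1])
  have pos: "0 \<le> B + w x" "B + w x \<le> 2 * B" for x using w[of x] by auto
  have pos': "0 \<le> B + v x" "B + v x \<le> 2 * B" for x using v[of x] by auto
  have "(\<integral>x. (B + w x) *\<^sub>R f (X x) \<partial>M) = (\<integral>x. (B + v x) *\<^sub>R f (Y x) \<partial>N)"
    by (rule weighted_expectation_eqI_char_nonneg[OF M N _ _ _ _ _ pos pos'])
      (simp_all add: split[OF ie(1)] split'[OF ie(2)] eq1 eq del: of_real_mult)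
  moreover have "(\<integral>x. f (X x) \<partial>M) = (\<integral>x. f (Y x) \<partial>N)"
  proof -
    have "(\<integral>x. 1 *\<^sub>R f (X x) \<partial>M) = (\<integral>x. 1 *\<^sub>R f (Y x) \<partial>N)"
      by (rule weighted_expectation_eqI_char_nonneg[OF M N, where B=1]) (unfold scaleR_one, rule_tac [10] eq1, simp_all)
    then show ?thesis by simp
  qed
  ultimately show ?thesis by (simp add: split[OF f(1)] split'[OF f(2)])
qed

text \<open>A one-dimensional uniqueness theorem that tolerates complex weights. It is what makes the
  passage to several dimensions possible one coordinate at a time: the factor
  \<open>exp (\<i> c \<cdot> X)\<close> carried by the other coordinates is such a weight. Adding a constant to the
  real and imaginary parts of the weight turns it into a density, so that Levy's theorem applies.\<close>

lemma weighted_expectation_eqI_char: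
  fixes X :: "'a \<Rightarrow> real" and Y :: "'b \<Rightarrow> real" and f :: "real \<Rightarrow> complex"
  assumes M: "finite_measure M" and N: "finite_measure N"
    and meas[measurable]: "X \<in> borel_measurable M" "Y \<in> borel_measurable N" "f \<in> borel_measurable borel"
      "w \<in> borel_measurable M" "v \<in> borel_measurable N"
    and w: "\<And>x. cmod (w x) \<le> B" and v: "\<And>x. cmod (v x) \<le> B"
    and f: "integrable M (\<lambda>x. f (X x))" "integrable N (\<lambda>x. f (Y x))"
    and eq1: "\<And>s. (\<integral>x. iexp (s * X x) \<partial>M) = (\<integral>x. iexp (s * Y x) \<partial>N)"
    and eq: "\<And>s. (\<integral>x. w x * iexp (s * X x) \<partial>M) = (\<integral>x. v x * iexp (s * Y x) \<partial>N)"
  shows "(\<integral>x. w x * f (X x) \<partial>M) = (\<integral>x. v x * f (Y x) \<partial>N)"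
proof -
  interpret M: finite_measure M by fact
  interpret N: finite_measure N by fact
  have B: "0 \<le> B" using w[of undefined] norm_ge_zero order_trans by blast
  have iw: "integrable M (\<lambda>x. u x * g x)" if "integrable M g" "u \<in> borel_measurable M" "\<And>x. cmod (u x) \<le> B"
    for g u :: "'a \<Rightarrow> complex"
    by (rule Bochner_Integration.integrable_bound[of _ "\<lambda>x. B * norm (g x)"])
      (use that B in \<open>auto intro!: AE_I2 mult_mono order_trans[OF _ abs_ge_self] simp: norm_mult\<close>)
  have iv: "integrable N (\<lambda>x. u x * g x)" if "integrable N g" "u \<in> borel_measurable N" "\<And>x. cmod (u x) \<le> B"
    for g u :: "'b \<Rightarrow> complex"
    by (rule Bochner_Integration.integrable_bound[of _ "\<lambda>x. B * norm (g x)"])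
      (use that B in \<open>auto intro!: AE_I2 mult_mono order_trans[OF _ abs_ge_self] simp: norm_mult\<close>)
  have ie: "integrable M (\<lambda>x. iexp (s * X x))" "integrable N (\<lambda>x. iexp (s * Y x))" for s
    by (auto intro!: M.integrable_const_bound[where B=1] N.integrable_const_bound[where B=1])
  have cnj_meas[measurable]: "(\<lambda>x. cnj (w x)) \<in> borel_measurable M" "(\<lambda>x. cnj (v x)) \<in> borel_measurable N"
    by (auto intro!: borel_measurable_continuous_on[of cnj] continuous_intros)
  have ReIm: "Re z *\<^sub>R u = (z * u + cnj z * u) / 2" "Im z *\<^sub>R u = (z * u - cnj z * u) / (2 * \<i>)" for z u
    by (simp_all add: complex_eq_iff)
  \<comment> \<open>Conjugating the hypothesis at \<open>- s\<close> yields it at \<open>s\<close>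
    for the conjugate weights. Real and imaginary parts are combinations of a weight and its
    conjugate, so they inherit it too.\<close>
  have conj: "(\<integral>x. cnj (w x) * iexp (s * X x) \<partial>M) = (\<integral>x. cnj (v x) * iexp (s * Y x) \<partial>N)" for s
  proof -
    have "(\<integral>x. cnj (w x) * iexp (s * X x) \<partial>M) = cnj (\<integral>x. w x * iexp (- s * X x) \<partial>M)"
      by (subst Bochner_Integration.integral_cnj[symmetric]) (simp add: exp_cnj)
    also have "\<dots> = cnj (\<integral>x. v x * iexp (- s * Y x) \<partial>N)" by (simp only: eq)
    also have "\<dots> = (\<integral>x. cnj (v x) * iexp (s * Y x) \<partial>N)"
      by (subst Bochner_Integration.integral_cnj[symmetric]) (simp add: exp_cnj)
    finally show ?thesis .
  qed
  have bRI: "\<bar>Re (w x)\<bar> \<le> B" "\<bar>Im (w x)\<bar> \<le> B" for x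
    using w[of x] abs_Re_le_cmod[of "w x"] abs_Im_le_cmod[of "w x"] by linarith+
  have bRI': "\<bar>Re (v x)\<bar> \<le> B" "\<bar>Im (v x)\<bar> \<le> B" for x
    using v[of x] abs_Re_le_cmod[of "v x"] abs_Im_le_cmod[of "v x"] by linarith+
  have Rew: "(\<integral>x. Re (w x) *\<^sub>R g x \<partial>M) = ((\<integral>x. w x * g x \<partial>M) + (\<integral>x. cnj (w x) * g x \<partial>M)) / 2"
    and Imw: "(\<integral>x. Im (w x) *\<^sub>R g x \<partial>M) = ((\<integral>x. w x * g x \<partial>M) - (\<integral>x. cnj (w x) * g x \<partial>M)) / (2 * \<i>)"
    if g: "integrable M g" for g
    using iw[OF g, of w] iw[OF g, of "\<lambda>x. cnj (w x)"] w cnj_meas(1)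
    unfolding ReIm by simp_all
  have Rev: "(\<integral>x. Re (v x) *\<^sub>R g x \<partial>N) = ((\<integral>x. v x * g x \<partial>N) + (\<integral>x. cnj (v x) * g x \<partial>N)) / 2"
    and Imv: "(\<integral>x. Im (v x) *\<^sub>R g x \<partial>N) = ((\<integral>x. v x * g x \<partial>N) - (\<integral>x. cnj (v x) * g x \<partial>N)) / (2 * \<i>)"
    if g: "integrable N g" for g
    using iv[OF g, of v] iv[OF g, of "\<lambda>x. cnj (v x)"] v cnj_meas(2)
    unfolding ReIm by simp_all
  have R: "(\<integral>x. Re (w x) *\<^sub>R f (X x) \<partial>M) = (\<integral>x. Re (v x) *\<^sub>R f (Y x) \<partial>N)"
    by (rule weighted_expectation_eqI_char_real[OF M N _ _ _ _ _ bRI(1) bRI'(1) f eq1])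
      (simp_all add: Rew[OF ie(1)] Rev[OF ie(2)] eq conj del: of_real_mult)
  have I: "(\<integral>x. Im (w x) *\<^sub>R f (X x) \<partial>M) = (\<integral>x. Im (v x) *\<^sub>R f (Y x) \<partial>N)"
    by (rule weighted_expectation_eqI_char_real[OF M N _ _ _ _ _ bRI(2) bRI'(2) f eq1])
      (simp_all add: Imw[OF ie(1)] Imv[OF ie(2)] eq conj del: of_real_mult)
  \<comment> \<open>The integral with weight \<open>w\<close> is recovered from those with weights
    \<open>Re w\<close> and \<open>Im w\<close> without any statement about the conjugate weight and
    \<open>f\<close>.\<close>
  have cancel: "a = c" if "(a + b) / 2 = (c + d) / 2" "(a - b) / (2 * \<i>) = (c - d) / (2 * \<i>)" for a b c d :: complex
  proof -
    have "a + b = c + d" using that(1) unfolding divide_cancel_right by simp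
    moreover have "a - b = c - d" using that(2) unfolding divide_cancel_right by simp
    ultimately have "(a + b) + (a - b) = (c + d) + (c - d)" by (simp only:)
    then show ?thesis by simp
  qed
  show ?thesis
    by (rule cancel[OF R[unfolded Rew[OF f(1)] Rev[OF f(2)]] I[unfolded Imw[OF f(1)] Imv[OF f(2)]]])
qed

text \<open>Induction on the coordinates that carry an indicator: the remaining exponential together
  with the indicators already in place is a weight of modulus at most one, and the one-dimensional
  theorem turns the exponential of a further coordinate into an indicator. With no exponential left,
  the masses of cylinder sets agree, and these determine a finite measure on the product.\<close>

lemma distr_PiM_eqI_char:
  fixes X :: "'i \<Rightarrow> 'a \<Rightarrow> real" and Y :: "'i \<Rightarrow> 'b \<Rightarrow> real"
  assumes M: "finite_measure M" and N: "finite_measure N"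
    and meas[measurable]: "\<And>i. X i \<in> borel_measurable M" "\<And>i. Y i \<in> borel_measurable N"
    and eq: "\<And>F c. finite F \<Longrightarrow>
      (\<integral>x. iexp (\<Sum>i\<in>F. c i * X i x) \<partial>M) = (\<integral>x. iexp (\<Sum>i\<in>F. c i * Y i x) \<partial>N)"
  shows "distr M (Pi\<^sub>M UNIV (\<lambda>_. borel)) (\<lambda>x i. X i x) = distr N (Pi\<^sub>M UNIV (\<lambda>_. borel)) (\<lambda>x i. Y i x)"
proof -
  interpret M: finite_measure M by fact
  interpret N: finite_measure N by fact
  have [measurable]: "(\<lambda>x i. X i x) \<in> measurable M (Pi\<^sub>M UNIV (\<lambda>_. borel))"
    "(\<lambda>x i. Y i x) \<in> measurable N (Pi\<^sub>M UNIV (\<lambda>_. borel))"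
    by (auto intro!: measurable_PiM_single')
  have key: "(\<integral>x. (iexp (\<Sum>i\<in>F. c i * X i x) * (\<Prod>j\<in>J. indicator (A j) (X j x)) :: complex) \<partial>M)
      = (\<integral>x. iexp (\<Sum>i\<in>F. c i * Y i x) * (\<Prod>j\<in>J. indicator (A j) (Y j x)) \<partial>N)"
    if "finite J" "\<And>j. j \<in> J \<Longrightarrow> A j \<in> sets borel" "finite F" for J F and A :: "'i \<Rightarrow> real set" and c
    using that
  proof (induction J arbitrary: F c rule: finite_induct)
    case empty
    then show ?case by (simp add: eq del: of_real_sum of_real_mult)
  next
    case (insert m J)
    then have [measurable]: "\<And>j. j \<in> J \<Longrightarrow> A j \<in> sets borel" "A m \<in> sets borel" by auto
    define w :: "'a \<Rightarrow> complex" where "w = (\<lambda>x. iexp (\<Sum>i\<in>F. c i * X i x) * (\<Prod>j\<in>J. indicator (A j) (X j x)))"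
    define v :: "'b \<Rightarrow> complex" where "v = (\<lambda>x. iexp (\<Sum>i\<in>F. c i * Y i x) * (\<Prod>j\<in>J. indicator (A j) (Y j x)))"
    have "w \<in> borel_measurable M" "v \<in> borel_measurable N"
      by (simp_all add: w_def v_def)
    have b: "cmod (\<Prod>j\<in>J. indicator (A j) (f j)) \<le> 1" for f
      by (auto simp: prod_norm[symmetric] intro!: prod_le_1 split: split_indicator)
    \<comment> \<open>A frequency \<open>s\<close> in coordinate \<open>m\<close> must be merged
      into the exponential before the induction hypothesis applies; if \<open>m\<close> already
      occurs in \<open>F\<close>, then \<open>s\<close> is added to its coefficient. This is why
      \<open>F\<close> and \<open>c\<close> are generalised in the induction.\<close>
    have lin: "(\<Sum>i\<in>insert m F. ((if m \<in> F then c else c(m := 0))(m := s + (if m \<in> F then c m else 0))) i * f i)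
        = (\<Sum>i\<in>F. c i * f i) + s * f m" for s and f :: "'i \<Rightarrow> real"
    proof (cases "m \<in> F")
      case True
      then have "insert m F = insert m (F - {m})" by auto
      then show ?thesis using True insert.prems(2) sum.remove[of F m "\<lambda>i. c i * f i"]
        by (simp add: sum.insert_remove distrib_right)
    next
      case False
      then show ?thesis using insert.prems(2) by simp (rule sum.cong; auto)
    qed
    have "(\<integral>x. w x * (indicator (A m) (X m x)) \<partial>M) = (\<integral>x. v x * (indicator (A m) (Y m x)) \<partial>N)"
    proof (rule weighted_expectation_eqI_char[OF M N, where B=1])
      show "(\<integral>x. iexp (s * X m x) \<partial>M) = (\<integral>x. iexp (s * Y m x) \<partial>N)" for s
        using eq[of "{m}" "\<lambda>_. s"] by simp
      show "(\<integral>x. w x * iexp (s * X m x) \<partial>M) = (\<integral>x. v x * iexp (s * Y m x) \<partial>N)" for s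
        using insert.IH[of "insert m F" "(if m \<in> F then c else c(m := 0))(m := s + (if m \<in> F then c m else 0))"]
          insert.prems unfolding lin
        by (simp add: w_def v_def distrib_left exp_add mult_ac)
      show "integrable M (\<lambda>x. indicator (A m) (X m x) :: complex)"
        by (auto intro!: M.integrable_const_bound[where B=1] split: split_indicator)
      show "integrable N (\<lambda>x. indicator (A m) (Y m x) :: complex)"
        by (auto intro!: N.integrable_const_bound[where B=1] split: split_indicator)
    qed (use b in \<open>auto simp: w_def v_def norm_mult simp del: of_real_sum of_real_mult\<close>)
    then show ?case using insert.hyps by (simp add: w_def v_def mult_ac)
  qed
  have ci: "(\<integral>x. indicator E x \<partial>P) = complex_of_real (measure P E)" if "E \<in> sets P" for E and P :: "('i \<Rightarrow> real) measure"
  proof -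
    have "(\<integral>x. indicator E x \<partial>P) = (\<integral>x. complex_of_real (indicator E x) \<partial>P)"
      by (intro Bochner_Integration.integral_cong) (auto split: split_indicator)
    also have "\<dots> = complex_of_real (\<integral>x. indicator E x \<partial>P)" by (rule integral_complex_of_real)
    finally show ?thesis using sets.sets_into_space[OF that] by (simp add: Int_absorb2)
  qed
  show ?thesis
  proof (rule measure_eqI_PiM_infinite)
    show "finite_measure (distr M (Pi\<^sub>M UNIV (\<lambda>_. borel)) (\<lambda>x i. X i x))"
      by (intro M.finite_measure_distr) measurable
    fix A :: "'i \<Rightarrow> real set" and J :: "'i set"
    assume J: "finite J" "J \<subseteq> UNIV" and A: "\<And>i. i \<in> J \<Longrightarrow> A i \<in> sets borel"
    let ?E = "prod_emb UNIV (\<lambda>_. borel) J (Pi\<^sub>E J A)"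
    have E: "?E \<in> sets (Pi\<^sub>M UNIV (\<lambda>_. borel))"
      using J A by (intro sets_PiM_I) auto
    have ind: "(indicator ?E (\<lambda>i. f i) :: complex) = (\<Prod>j\<in>J. indicator (A j) (f j))" for f
      using J by (auto simp: prod_emb_def PiE_iff indicator_def)
    have "(\<integral>x. indicator ?E (\<lambda>i. X i x) \<partial>M) = (\<integral>x. (indicator ?E (\<lambda>i. Y i x) :: complex) \<partial>N)"
      using key[of J A "{}" "\<lambda>_. 0"] J A by (simp add: ind)
    also have "(\<integral>x. (indicator ?E (\<lambda>i. X i x) :: complex) \<partial>M) = (\<integral>y. indicator ?E y \<partial>distr M (Pi\<^sub>M UNIV (\<lambda>_. borel)) (\<lambda>x i. X i x))"
      using E by (subst integral_distr) auto
    also have "(\<integral>x. (indicator ?E (\<lambda>i. Y i x) :: complex) \<partial>N) = (\<integral>y. indicator ?E y \<partial>distr N (Pi\<^sub>M UNIV (\<lambda>_. borel)) (\<lambda>x i. Y i x))"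
      using E by (subst integral_distr) auto
    finally have "measure (distr M (Pi\<^sub>M UNIV (\<lambda>_. borel)) (\<lambda>x i. X i x)) ?E = measure (distr N (Pi\<^sub>M UNIV (\<lambda>_. borel)) (\<lambda>x i. Y i x)) ?E"
      by (subst (asm) (1 2) ci) (use E in \<open>simp_all del: of_real_eq_iff add: of_real_eq_iff\<close>)
    moreover have "finite_measure (distr M (Pi\<^sub>M UNIV (\<lambda>_. borel)) (\<lambda>x i. X i x))" "finite_measure (distr N (Pi\<^sub>M UNIV (\<lambda>_. borel)) (\<lambda>x i. Y i x))"
      by (auto intro!: M.finite_measure_distr N.finite_measure_distr)
    ultimately show "emeasure (distr M (Pi\<^sub>M UNIV (\<lambda>_. borel)) (\<lambda>x i. X i x)) ?E = emeasure (distr N (Pi\<^sub>M UNIV (\<lambda>_. borel)) (\<lambda>x i. Y i x)) ?E"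
      by (simp add: finite_measure.emeasure_eq_measure)
  qed auto
qed

section \<open>Exponential tilting of Gaussian variables\<close>

lemma abs_mult_le_sum_squares: "\<bar>x * y\<bar> \<le> x\<^sup>2 + (y::real)\<^sup>2"
  using sum_squares_bound[of "\<bar>x\<bar>" "\<bar>y\<bar>"] mult_nonneg_nonneg[of "\<bar>x\<bar>" "\<bar>y\<bar>"]
  unfolding abs_mult power2_abs by linarith

lemma centered_gaussian_rv_measurable:
  "centered_gaussian_rv M X \<Longrightarrow> X \<in> borel_measurable M"
  by (simp add: centered_gaussian_rv_def)

lemma centered_gaussian_rv_iexp:
  assumes "centered_gaussian_rv M X"
  shows "(\<integral>x. iexp (s * X x) \<partial>M) = exp (- (s\<^sup>2 * (\<integral>x. (X x)\<^sup>2 \<partial>M)) / 2)"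
proof -
  have "char (distr M borel X) s = (\<integral>x. iexp (s * X x) \<partial>M)"
    unfolding char_def using centered_gaussian_rv_measurable[OF assms] by (subst integral_distr) auto
  with assms show ?thesis
    unfolding centered_gaussian_rv_def by metis
qed

lemma centered_gaussian_rv_AE_zero:
  assumes "centered_gaussian_rv M X" "(\<integral>x. (X x)\<^sup>2 \<partial>M) = 0"
  shows "AE x in M. X x = 0"
  using assms integral_nonneg_eq_0_iff_AE[of M "\<lambda>x. (X x)\<^sup>2"] by (simp add: centered_gaussian_rv_def)

lemma centered_gaussian_rv_standardize:
  assumes "prob_space M" "centered_gaussian_rv M X" and \<sigma>: "\<sigma> > 0" "(\<integral>x. (X x)\<^sup>2 \<partial>M) = \<sigma>\<^sup>2"
  shows "distr M borel (\<lambda>x. X x / \<sigma>) = density lborel std_normal_density"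
proof -
  interpret prob_space M by fact
  note [measurable] = centered_gaussian_rv_measurable[OF assms(2)]
  show ?thesis
  proof (rule Levy_uniqueness)
    show "real_distribution (distr M borel (\<lambda>x. X x / \<sigma>))"
      by (rule real_distribution_distr) measurable
    show "real_distribution (density lborel std_normal_density)"
      by (rule real_dist_normal_dist)
    show "char (distr M borel (\<lambda>x. X x / \<sigma>)) = char (density lborel std_normal_density)"
    proof
      fix s
      have "char (distr M borel (\<lambda>x. X x / \<sigma>)) s = (\<integral>x. iexp ((s / \<sigma>) * X x) \<partial>M)"
        unfolding char_def by (subst integral_distr) auto
      also have "\<dots> = exp (- (s\<^sup>2) / 2)"
        unfolding centered_gaussian_rv_iexp[OF assms(2)] using \<sigma> by (simp add: power_divide)
      finally show "char (distr M borel (\<lambda>x. X x / \<sigma>)) s = char (density lborel std_normal_density) s"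
        by (simp add: char_std_normal_distribution)
    qed
  qed
qed

text \<open>The one-dimensional Cameron--Martin formula. In the standardised variable the
  exponential weight is a translation by \<sigma>, hence a translation of \<open>X\<close> by
  \<sigma>*\<sigma> = \<open>v\<close>. Zero variance admits no density and is treated
  apart.\<close>

lemma centered_gaussian_rv_tilt:
  assumes "prob_space M" "centered_gaussian_rv M X" and v: "(\<integral>x. (X x)\<^sup>2 \<partial>M) = v"
  shows "distr (density M (\<lambda>x. ennreal (exp (X x - v / 2)))) borel X = distr M borel (\<lambda>x. X x + v)"
proof (rule measure_eqI)
  interpret prob_space M by fact
  note [measurable] = centered_gaussian_rv_measurable[OF assms(2)]
  fix A assume "A \<in> sets (distr (density M (\<lambda>x. ennreal (exp (X x - v / 2)))) borel X)"
  then have A[measurable]: "A \<in> sets borel" by simp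
  have l: "emeasure (distr (density M (\<lambda>x. ennreal (exp (X x - v / 2)))) borel X) A
      = (\<integral>\<^sup>+x. ennreal (exp (X x - v / 2)) * indicator A (X x) \<partial>M)"
    by (simp add: emeasure_distr emeasure_density) (auto intro!: nn_integral_cong split: split_indicator)
  have "emeasure (distr M borel (\<lambda>x. X x + v)) A = (\<integral>\<^sup>+y. indicator A y \<partial>(distr M borel (\<lambda>x. X x + v)))"
    by simp
  also have "\<dots> = (\<integral>\<^sup>+x. indicator A (X x + v) \<partial>M)"
    by (subst nn_integral_distr) auto
  finally have r: "emeasure (distr M borel (\<lambda>x. X x + v)) A = (\<integral>\<^sup>+x. indicator A (X x + v) \<partial>M)" .
  have v0: "v \<ge> 0" using v by auto
  have "(\<integral>\<^sup>+x. ennreal (exp (X x - v / 2)) * indicator A (X x) \<partial>M) = (\<integral>\<^sup>+x. indicator A (X x + v) \<partial>M)"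
  proof (cases "v = 0")
    case True
    with v have "AE x in M. X x = 0" using centered_gaussian_rv_AE_zero[OF assms(2)] by simp
    then show ?thesis using True by (intro nn_integral_cong_AE) auto
  next
    case False
    define \<sigma> where "\<sigma> = sqrt v"
    have \<sigma>: "\<sigma> > 0" "v = \<sigma>\<^sup>2" using v0 False by (auto simp: \<sigma>_def)
    have std: "(\<integral>\<^sup>+x. g (X x) \<partial>M) = (\<integral>\<^sup>+y. ennreal (std_normal_density y) * g (\<sigma> * y) \<partial>lborel)"
      if [measurable]: "g \<in> borel_measurable borel" for g
    proof -
      have "(\<integral>\<^sup>+x. g (X x) \<partial>M) = (\<integral>\<^sup>+y. g (\<sigma> * y) \<partial>distr M borel (\<lambda>x. X x / \<sigma>))"
        using \<sigma> by (subst nn_integral_distr) auto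
      then show ?thesis
        using \<sigma> v by (simp add: centered_gaussian_rv_standardize[OF assms(1,2)] nn_integral_density)
    qed
    have "(\<integral>\<^sup>+x. ennreal (exp (X x - v / 2)) * indicator A (X x) \<partial>M)
      = (\<integral>\<^sup>+y. ennreal (std_normal_density y) * (ennreal (exp (\<sigma> * y - v / 2)) * indicator A (\<sigma> * y)) \<partial>lborel)"
      by (rule std) measurable
    also have "\<dots> = (\<integral>\<^sup>+y. ennreal (std_normal_density (\<sigma> + y)) * (ennreal (exp (\<sigma> * (\<sigma> + y) - v / 2)) * indicator A (\<sigma> * (\<sigma> + y))) \<partial>lborel)"
      by (subst nn_integral_real_affine[where c=1 and t=\<sigma>]) auto
    also have "\<dots> = (\<integral>\<^sup>+y. ennreal (std_normal_density y) * indicator A (\<sigma> * y + v) \<partial>lborel)"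
    proof (intro nn_integral_cong)
      fix y
      \<comment> \<open>Completing the square: -(\<sigma> + y)^2/2 + \<sigma>(\<sigma> + y) -
        \<sigma>^2/2 = -y^2/2.\<close>
      have "std_normal_density (\<sigma> + y) * exp (\<sigma> * (\<sigma> + y) - v / 2) = std_normal_density y"
        unfolding std_normal_density_def \<sigma>(2) mult.assoc exp_add[symmetric]
        by (simp add: power2_eq_square field_simps)
      then have "ennreal (std_normal_density (\<sigma> + y)) * ennreal (exp (\<sigma> * (\<sigma> + y) - v / 2)) = ennreal (std_normal_density y)"
        by (simp add: ennreal_mult[symmetric])
      then show "ennreal (std_normal_density (\<sigma> + y)) * (ennreal (exp (\<sigma> * (\<sigma> + y) - v / 2)) * indicator A (\<sigma> * (\<sigma> + y)))
        = ennreal (std_normal_density y) * indicator A (\<sigma> * y + v)"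
        unfolding mult.assoc[symmetric] by (simp add: \<sigma>(2) power2_eq_square distrib_left add.commute)
    qed
    also have "\<dots> = (\<integral>\<^sup>+x. indicator A (X x + v) \<partial>M)"
      by (subst std) auto
    finally show ?thesis .
  qed
  then show "emeasure (distr (density M (\<lambda>x. ennreal (exp (X x - v / 2)))) borel X) A
     = emeasure (distr M borel (\<lambda>x. X x + v)) A"
    by (simp add: l r)
qed simp

text \<open>The moment generating function is read off from the total mass of the tilted law, which
  is one because a translated probability law has mass one.\<close>

lemma centered_gaussian_rv_exp:
  assumes "prob_space M" "centered_gaussian_rv M X"
  shows "(\<integral>\<^sup>+x. ennreal (exp (X x)) \<partial>M) = ennreal (exp ((\<integral>x. (X x)\<^sup>2 \<partial>M) / 2))"
proof -
  interpret prob_space M by fact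
  note [measurable] = centered_gaussian_rv_measurable[OF assms(2)]
  define v where "v = (\<integral>x. (X x)\<^sup>2 \<partial>M)"
  have "(\<integral>\<^sup>+x. ennreal (exp (X x - v / 2)) \<partial>M) = emeasure (distr (density M (\<lambda>x. ennreal (exp (X x - v / 2)))) borel X) UNIV"
    by (simp add: emeasure_distr emeasure_density cong: nn_integral_cong)
  also have "\<dots> = 1"
    unfolding centered_gaussian_rv_tilt[OF assms v_def[symmetric]] by (simp add: emeasure_distr emeasure_space_1)
  finally have one: "(\<integral>\<^sup>+x. ennreal (exp (X x - v / 2)) \<partial>M) = 1" .
  have "(\<integral>\<^sup>+x. ennreal (exp (X x)) \<partial>M) = (\<integral>\<^sup>+x. ennreal (exp (v / 2)) * ennreal (exp (X x - v / 2)) \<partial>M)"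
    by (simp add: ennreal_mult[symmetric] exp_add[symmetric])
  also have "\<dots> = ennreal (exp (v / 2))" by (simp add: nn_integral_cmult one)
  finally show ?thesis by (simp add: v_def)
qed

text \<open>Decompose \<open>L = \<alpha> U + R\<close> with \<open>R\<close> uncorrelated with \<open>U\<close>; then the weight \<open>exp (\<i> R)\<close> may be
  replaced by its mean, and only a one-dimensional tilt of \<open>U\<close> remains.\<close>

lemma gaussian_pair_tilted_iexp:
  assumes "prob_space M" and G: "\<And>a b. centered_gaussian_rv M (\<lambda>x. a * U x + b * L x)"
  shows "(\<integral>x. exp (U x - (\<integral>x. (U x)\<^sup>2 \<partial>M) / 2) *\<^sub>R iexp (L x) \<partial>M)
    = iexp (\<integral>x. U x * L x \<partial>M) * exp (- (\<integral>x. (L x)\<^sup>2 \<partial>M) / 2)"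
proof -
  interpret prob_space M by fact
  have gU: "centered_gaussian_rv M U" and gL: "centered_gaussian_rv M L"
    using G[of 1 0] G[of 0 1] by simp_all
  note [measurable] = gU[THEN centered_gaussian_rv_measurable] gL[THEN centered_gaussian_rv_measurable]
  define v \<rho> \<tau> where "v = (\<integral>x. (U x)\<^sup>2 \<partial>M)" and "\<rho> = (\<integral>x. U x * L x \<partial>M)" and "\<tau> = (\<integral>x. (L x)\<^sup>2 \<partial>M)"
  have iU: "integrable M (\<lambda>x. (U x)\<^sup>2)" and iL: "integrable M (\<lambda>x. (L x)\<^sup>2)"
    using gU gL by (simp_all add: centered_gaussian_rv_def)
  have iUL: "integrable M (\<lambda>x. U x * L x)"
  proof (rule Bochner_Integration.integrable_bound[of _ "\<lambda>x. (U x)\<^sup>2 + (L x)\<^sup>2"])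
    show "AE x in M. norm (U x * L x) \<le> norm ((U x)\<^sup>2 + (L x)\<^sup>2)"
      using abs_mult_le_sum_squares by simp
  qed (use iU iL in auto)
  have var: "(\<integral>x. (a * U x + b * L x)\<^sup>2 \<partial>M) = a\<^sup>2 * v + 2 * a * b * \<rho> + b\<^sup>2 * \<tau>" for a b
  proof -
    have "(\<integral>x. (a * U x + b * L x)\<^sup>2 \<partial>M) = (\<integral>x. a\<^sup>2 * (U x)\<^sup>2 + 2 * a * b * (U x * L x) + b\<^sup>2 * (L x)\<^sup>2 \<partial>M)"
      by (intro Bochner_Integration.integral_cong) (auto simp: power2_eq_square algebra_simps)
    then show ?thesis using iU iL iUL by (simp add: v_def \<rho>_def \<tau>_def)
  qed
  have ie: "(\<integral>x. iexp (a * U x + b * L x) \<partial>M) = complex_of_real (exp (- (a\<^sup>2 * v + 2 * a * b * \<rho> + b\<^sup>2 * \<tau>) / 2))" for a b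
    using centered_gaussian_rv_iexp[OF G[of a b], of 1] unfolding var by simp
  show ?thesis
  proof (cases "v = 0")
    case True
    then have U0: "AE x in M. U x = 0"
      using centered_gaussian_rv_AE_zero[OF gU] by (simp add: v_def)
    have "\<rho> = (\<integral>x. 0 \<partial>M)"
      unfolding \<rho>_def using U0 by (intro integral_cong_AE) auto
    moreover have "(\<integral>x. exp (U x - v / 2) *\<^sub>R iexp (L x) \<partial>M) = (\<integral>x. iexp (L x) \<partial>M)"
      using U0 True by (intro integral_cong_AE) auto
    ultimately show ?thesis using ie[of 0 1] by (simp add: v_def \<rho>_def \<tau>_def)
  next
    case False
    define \<alpha> where "\<alpha> = \<rho> / v"
    have \<rho>: "\<rho> = \<alpha> * v" using False by (simp add: \<alpha>_def)
    define f where "f u = exp (u - v / 2) *\<^sub>R iexp (\<alpha> * u)" for u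
    have [measurable]: "f \<in> borel_measurable borel" unfolding f_def by measurable
    have ie1: "integrable M (\<lambda>x. exp (U x - v / 2))"
      unfolding exp_diff using centered_gaussian_rv_exp[OF assms(1) gU] by (intro integrable_divide integrableI_nonneg) auto
    have if': "integrable M (\<lambda>x. f (U x))"
      by (rule Bochner_Integration.integrable_bound[OF ie1]) (auto simp: f_def)
    have iR: "(\<integral>x. iexp (L x - \<alpha> * U x) \<partial>M) = complex_of_real (exp (- (\<tau> - \<alpha>\<^sup>2 * v) / 2))"
      using ie[of "- \<alpha>" 1] by (simp add: \<rho> power2_eq_square algebra_simps)
    have iU: "(\<integral>x. iexp (s * U x) \<partial>M) = complex_of_real (exp (- (s\<^sup>2 * v) / 2))" for s
      using ie[of s 0] by simp
    \<comment> \<open>The two weights compared are \<open>iexp\<close> of the residual and its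
      constant mean. Their agreement against \<open>iexp (s * U x)\<close> is the factorisation of a
      joint characteristic function: \<open>(s - \<alpha>) * U + L\<close> has variance s^2 v +
      (\<tau> - \<alpha>^2 v), since \<rho> = \<alpha> v.\<close>
    have "(\<integral>x. iexp (L x - \<alpha> * U x) * f (U x) \<partial>M) = (\<integral>x. (\<integral>y. iexp (L y - \<alpha> * U y) \<partial>M) * f (U x) \<partial>M)"
    proof (rule weighted_expectation_eqI_char[where B=1])
      show "cmod (\<integral>y. iexp (L y - \<alpha> * U y) \<partial>M) \<le> 1"
        by (rule order_trans[OF integral_norm_bound]) (simp add: prob_space)
      fix s
      have "(\<integral>x. iexp (L x - \<alpha> * U x) * iexp (s * U x) \<partial>M) = (\<integral>x. iexp ((s - \<alpha>) * U x + 1 * L x) \<partial>M)"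
        by (intro Bochner_Integration.integral_cong) (auto simp: exp_add[symmetric] algebra_simps)
      also have "\<dots> = complex_of_real (exp (- (\<tau> - \<alpha>\<^sup>2 * v) / 2)) * complex_of_real (exp (- (s\<^sup>2 * v) / 2))"
        unfolding ie of_real_mult[symmetric] exp_add[symmetric] \<rho> by (simp add: power2_eq_square field_simps)
      finally show "(\<integral>x. iexp (L x - \<alpha> * U x) * iexp (s * U x) \<partial>M) = (\<integral>x. (\<integral>y. iexp (L y - \<alpha> * U y) \<partial>M) * iexp (s * U x) \<partial>M)"
        unfolding integral_mult_right_zero iR iU .
    qed (use if' finite_measure_axioms in auto)
    also have "\<dots> = complex_of_real (exp (- (\<tau> - \<alpha>\<^sup>2 * v) / 2)) * (\<integral>x. f (U x) \<partial>M)"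
      unfolding integral_mult_right_zero iR ..
    \<comment> \<open>The real exponential in \<open>f\<close> becomes a density. The tilt then
      moves \<open>U\<close> by \<open>v\<close>, which produces the phase \<alpha> v =
      \<rho>.\<close>
    also have "(\<integral>x. f (U x) \<partial>M) = (\<integral>u. iexp (\<alpha> * u) \<partial>distr (density M (\<lambda>x. ennreal (exp (U x - v / 2)))) borel U)"
      unfolding f_def by (subst integral_distr) (auto simp: integral_density)
    also have "\<dots> = (\<integral>x. iexp (\<alpha> * (U x + v)) \<partial>M)"
      unfolding centered_gaussian_rv_tilt[OF assms(1) gU v_def[symmetric]] by (subst integral_distr) auto
    also have "\<dots> = (\<integral>x. iexp \<rho> * iexp (\<alpha> * U x) \<partial>M)"
      by (intro Bochner_Integration.integral_cong) (auto simp: \<rho> exp_add[symmetric] algebra_simps)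
    also have "\<dots> = iexp \<rho> * complex_of_real (exp (- (\<alpha>\<^sup>2 * v) / 2))"
      unfolding integral_mult_right_zero iU ..
    also have "complex_of_real (exp (- (\<tau> - \<alpha>\<^sup>2 * v) / 2)) * (iexp \<rho> * complex_of_real (exp (- (\<alpha>\<^sup>2 * v) / 2)))
        = iexp \<rho> * complex_of_real (exp (- (\<tau> - \<alpha>\<^sup>2 * v) / 2) * exp (- (\<alpha>\<^sup>2 * v) / 2))"
      by simp
    also have "exp (- (\<tau> - \<alpha>\<^sup>2 * v) / 2) * exp (- (\<alpha>\<^sup>2 * v) / 2) = exp (- \<tau> / 2)"
      unfolding exp_add[symmetric] by (simp add: field_simps)
    also have "(\<integral>x. iexp (L x - \<alpha> * U x) * f (U x) \<partial>M) = (\<integral>x. exp (U x - v / 2) *\<^sub>R iexp (L x) \<partial>M)"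
      by (intro Bochner_Integration.integral_cong)
        (auto simp: f_def scaleR_conv_of_real mult.left_commute exp_add[symmetric] algebra_simps)
    finally show ?thesis by (simp add: v_def \<rho>_def \<tau>_def)
  qed
qed

section \<open>Measurability of path functionals\<close>

text \<open>Path functionals such as \<open>\<integral> Z\<close> are not measurable for the product \<open>\<sigma>\<close>-algebra on all functions
  \<open>real \<Rightarrow> real\<close>. Replacing evaluation by a limit along rational times, which changes nothing on
  continuous paths, makes them so.\<close>

definition path_eval :: "real \<Rightarrow> (real \<Rightarrow> real) \<Rightarrow> real" where
  "path_eval t x = lim (\<lambda>n. x (of_int \<lfloor>real (Suc n) * t\<rfloor> / real (Suc n)))"

lemma path_eval_continuous:
  assumes "continuous_on UNIV x"
  shows "path_eval t x = x t"
proof -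
  have "(\<lambda>n. of_int \<lfloor>real (Suc n) * t\<rfloor> / real (Suc n)) \<longlonglongrightarrow> t"
  proof (rule real_tendsto_sandwich)
    show "(\<lambda>n. t - 1 / real (Suc n)) \<longlonglongrightarrow> t"
      using tendsto_diff[OF tendsto_const[of t] LIMSEQ_inverse_real_of_nat] by (simp add: inverse_eq_divide)
    show "\<forall>\<^sub>F n in sequentially. t - 1 / real (Suc n) \<le> of_int \<lfloor>real (Suc n) * t\<rfloor> / real (Suc n)"
    proof (rule always_eventually, rule allI)
      fix n
      have "real (Suc n) * t - 1 \<le> of_int \<lfloor>real (Suc n) * t\<rfloor>" by linarith
      from divide_right_mono[OF this, of "real (Suc n)"]
      show "t - 1 / real (Suc n) \<le> of_int \<lfloor>real (Suc n) * t\<rfloor> / real (Suc n)"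
        by (simp add: diff_divide_distrib)
    qed
    show "\<forall>\<^sub>F n in sequentially. of_int \<lfloor>real (Suc n) * t\<rfloor> / real (Suc n) \<le> t"
    proof (rule always_eventually, rule allI)
      fix n
      have "of_int \<lfloor>real (Suc n) * t\<rfloor> \<le> real (Suc n) * t" by linarith
      from divide_right_mono[OF this, of "real (Suc n)"]
      show "of_int \<lfloor>real (Suc n) * t\<rfloor> / real (Suc n) \<le> t" by simp
    qed
  qed simp
  then have "(\<lambda>n. x (of_int \<lfloor>real (Suc n) * t\<rfloor> / real (Suc n))) \<longlonglongrightarrow> x t"
    using assms by (intro isCont_tendsto_compose[of t x]) (auto simp: continuous_on_eq_continuous_at)
  then show ?thesis unfolding path_eval_def by (rule limI)
qed

text \<open>For each \<open>n\<close> only the countably many times k / (n + 1) are visited, so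
  measurability of the single coordinates gives joint measurability, and \<open>lim\<close>
  preserves it even where the sequence diverges.\<close>

lemma path_eval_measurable:
  assumes [measurable]: "\<And>t. X t \<in> borel_measurable M"
  shows "(\<lambda>p. path_eval (snd p) (\<lambda>s. X s (fst p))) \<in> borel_measurable (M \<Otimes>\<^sub>M borel)"
  unfolding path_eval_def
proof (rule borel_measurable_lim_metric)
  fix n
  show "(\<lambda>p. X (of_int \<lfloor>real (Suc n) * snd p\<rfloor> / real (Suc n)) (fst p)) \<in> borel_measurable (M \<Otimes>\<^sub>M borel)"
    by (rule measurable_compose_countable[where f="\<lambda>k p. X (of_int k / real (Suc n)) (fst p)"
          and g="\<lambda>p. \<lfloor>real (Suc n) * snd p\<rfloor>"]) measurable
qed

lemma fbm_Z_pos [simp]: "0 < fbm_Z H X t \<omega>"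
  by (simp add: fbm_Z_def)

lemma fbm_Z_nonneg [simp]: "0 \<le> fbm_Z H X t \<omega>"
  by (simp add: fbm_Z_def)

lemma fbm_Z_measurable:
  assumes [measurable]: "(\<lambda>p. X (snd p) (fst p)) \<in> borel_measurable (M \<Otimes>\<^sub>M borel)"
  shows "(\<lambda>p. fbm_Z H X (snd p) (fst p)) \<in> borel_measurable (M \<Otimes>\<^sub>M borel)"
  unfolding fbm_Z_def by measurable

lemma borel_measurable_lborel_integral:
  fixes f :: "'a \<Rightarrow> real \<Rightarrow> real"
  assumes "(\<lambda>p. f (fst p) (snd p)) \<in> borel_measurable (M \<Otimes>\<^sub>M borel)"
  shows "(\<lambda>\<omega>. \<integral>t. f \<omega> t \<partial>lborel) \<in> borel_measurable M"
  by (rule lborel.borel_measurable_lebesgue_integral)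
    (use assms in \<open>simp add: case_prod_beta' cong: measurable_cong_sets sets_pair_measure_cong\<close>)

lemma fbm_q_measurable:
  assumes "(\<lambda>p. X (snd p) (fst p)) \<in> borel_measurable (M \<Otimes>\<^sub>M borel)"
  shows "(\<lambda>p. fbm_q H X (snd p) (fst p)) \<in> borel_measurable (M \<Otimes>\<^sub>M borel)"
proof -
  note Z[measurable] = fbm_Z_measurable[OF assms, of H]
  have [measurable]: "(\<lambda>\<omega>. \<integral>u. fbm_Z H X u \<omega> \<partial>lborel) \<in> borel_measurable M"
    by (rule borel_measurable_lborel_integral) (rule Z)
  show ?thesis unfolding fbm_q_def by measurable
qed

lemma fbm_zeta_measurable:
  assumes "(\<lambda>p. X (snd p) (fst p)) \<in> borel_measurable (M \<Otimes>\<^sub>M borel)"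
  shows "fbm_zeta H X \<in> borel_measurable M"
proof -
  note [measurable] = fbm_q_measurable[OF assms, of H]
  have "(\<lambda>\<omega>. \<integral>t. t * fbm_q H X t \<omega> \<partial>lborel) \<in> borel_measurable M"
    by (rule borel_measurable_lborel_integral) measurable
  then show ?thesis unfolding fbm_zeta_def[abs_def] .
qed

lemma measurable_section:
  assumes "(\<lambda>p. f (snd p) (fst p)) \<in> borel_measurable (M \<Otimes>\<^sub>M borel)"
  shows "f (t::real) \<in> borel_measurable M"
  using measurable_compose[OF _ assms, of "\<lambda>\<omega>. (\<omega>, t)" M] by simp

section \<open>Cameron--Martin formula for fractional Brownian motion\<close>

locale fbm = prob_space M for M :: "'a measure" +
  fixes H :: real and W :: "real \<Rightarrow> 'a \<Rightarrow> real"
  assumes H_pos: "0 < H" and fbm: "two_sided_fbm M H W"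
begin

section \<open>The variance function and the Gaussian space of \<open>W\<close>\<close>

abbreviation nu :: "real \<Rightarrow> real" where "nu t \<equiv> \<bar>t\<bar> powr (2 * H)"

text \<open>The Gaussian space generated by the process. Increments and sums of increments are shown
  to be centred Gaussian by membership, through closure under linear operations.\<close>

definition lin_span :: "('a \<Rightarrow> real) set" where
  "lin_span = {X. \<exists>F c. finite F \<and> X = (\<lambda>\<omega>. \<Sum>t\<in>F. c t * W t \<omega>)}"

lemma lin_span_gaussian: "X \<in> lin_span \<Longrightarrow> centered_gaussian_rv M X"
  using fbm by (auto simp: lin_span_def two_sided_fbm_def centered_gaussian_process_def)

lemma lin_span_W: "W t \<in> lin_span"
  unfolding lin_span_def by (auto intro!: exI[of _ "{t}"] exI[of _ "\<lambda>_. 1"])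

lemma lin_span_scale:
  assumes "X \<in> lin_span"
  shows "(\<lambda>\<omega>. a * X \<omega>) \<in> lin_span"
proof -
  from assms obtain F c where "finite F" "X = (\<lambda>\<omega>. \<Sum>t\<in>F. c t * W t \<omega>)"
    by (auto simp: lin_span_def)
  then show ?thesis unfolding lin_span_def
    by (auto intro!: exI[of _ F] exI[of _ "\<lambda>t. a * c t"] simp: sum_distrib_left mult.assoc)
qed

lemma lin_span_add:
  assumes "X \<in> lin_span" "Y \<in> lin_span"
  shows "(\<lambda>\<omega>. X \<omega> + Y \<omega>) \<in> lin_span"
proof -
  from assms obtain F c F' c' where F: "finite F" "X = (\<lambda>\<omega>. \<Sum>t\<in>F. c t * W t \<omega>)"
    and F': "finite F'" "Y = (\<lambda>\<omega>. \<Sum>t\<in>F'. c' t * W t \<omega>)"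
    by (auto simp: lin_span_def)
  let ?c = "\<lambda>t. (if t \<in> F then c t else 0) + (if t \<in> F' then c' t else 0)"
  have "(\<Sum>t\<in>F \<union> F'. ?c t * W t \<omega>) = X \<omega> + Y \<omega>" for \<omega>
  proof -
    have "(\<Sum>t\<in>F \<union> F'. ?c t * W t \<omega>)
        = (\<Sum>t\<in>F \<union> F'. (if t \<in> F then c t else 0) * W t \<omega>) + (\<Sum>t\<in>F \<union> F'. (if t \<in> F' then c' t else 0) * W t \<omega>)"
      by (simp add: distrib_right sum.distrib)
    also have "(\<Sum>t\<in>F \<union> F'. (if t \<in> F then c t else 0) * W t \<omega>) = X \<omega>"
      unfolding F(2) using F(1) F'(1) by (intro sum.mono_neutral_cong_right) auto
    also have "(\<Sum>t\<in>F \<union> F'. (if t \<in> F' then c' t else 0) * W t \<omega>) = Y \<omega>"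
      unfolding F'(2) using F(1) F'(1) by (intro sum.mono_neutral_cong_right) auto
    finally show ?thesis .
  qed
  then show ?thesis unfolding lin_span_def
    using F(1) F'(1) by (auto intro!: exI[of _ "F \<union> F'"] exI[of _ ?c])
qed

lemma lin_span_diff: "X \<in> lin_span \<Longrightarrow> Y \<in> lin_span \<Longrightarrow> (\<lambda>\<omega>. X \<omega> - Y \<omega>) \<in> lin_span"
  using lin_span_add[of X "\<lambda>\<omega>. (-1) * Y \<omega>"] lin_span_scale[of Y "-1"] by simp

lemma lin_span_sum:
  assumes "finite F" "\<And>i. i \<in> F \<Longrightarrow> X i \<in> lin_span"
  shows "(\<lambda>\<omega>. \<Sum>i\<in>F. X i \<omega>) \<in> lin_span"
  using assms
proof (induction F rule: finite_induct)
  case empty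
  show ?case using lin_span_scale[OF lin_span_W, of 0] by simp
next
  case (insert i F)
  then show ?case using lin_span_add[of "X i" "\<lambda>\<omega>. \<Sum>i\<in>F. X i \<omega>"] by simp
qed

lemmas lin_span_measurable = centered_gaussian_rv_measurable[OF lin_span_gaussian]

lemma W_measurable [measurable]: "W t \<in> borel_measurable M"
  by (rule lin_span_measurable[OF lin_span_W])

lemma W_continuous: "\<omega> \<in> space M \<Longrightarrow> continuous_on UNIV (\<lambda>t. W t \<omega>)"
  using fbm by (simp add: two_sided_fbm_def)

lemma W_0: "\<omega> \<in> space M \<Longrightarrow> W 0 \<omega> = 0"
  using fbm by (simp add: two_sided_fbm_def)

lemma lin_span_integrable_mult:
  assumes "X \<in> lin_span" "Y \<in> lin_span"
  shows "integrable M (\<lambda>\<omega>. X \<omega> * Y \<omega>)"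
proof (rule Bochner_Integration.integrable_bound[of _ "\<lambda>\<omega>. (X \<omega>)\<^sup>2 + (Y \<omega>)\<^sup>2"])
  note [measurable] = assms[THEN lin_span_measurable]
  show "integrable M (\<lambda>\<omega>. (X \<omega>)\<^sup>2 + (Y \<omega>)\<^sup>2)"
    using assms[THEN lin_span_gaussian] by (simp add: centered_gaussian_rv_def)
  show "(\<lambda>\<omega>. X \<omega> * Y \<omega>) \<in> borel_measurable M" by measurable
  show "AE \<omega> in M. norm (X \<omega> * Y \<omega>) \<le> norm ((X \<omega>)\<^sup>2 + (Y \<omega>)\<^sup>2)"
    using abs_mult_le_sum_squares by simp
qed

section \<open>Covariances and stationarity of increments\<close>

lemma W_diff_square: "expectation (\<lambda>\<omega>. (W s \<omega> - W t \<omega>)\<^sup>2) = nu (s - t)"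
  using fbm by (simp add: two_sided_fbm_def)

lemma W_square: "expectation (\<lambda>\<omega>. (W t \<omega>)\<^sup>2) = nu t"
proof -
  have "expectation (\<lambda>\<omega>. (W t \<omega>)\<^sup>2) = expectation (\<lambda>\<omega>. (W t \<omega> - W 0 \<omega>)\<^sup>2)"
    by (intro Bochner_Integration.integral_cong) (auto simp: W_0)
  then show ?thesis by (simp add: W_diff_square)
qed

text \<open>Polarisation: expand the square of \<open>W s - W t\<close>, whose mean is given, and
  use \<open>W 0 = 0\<close> for the variances of the single terms.\<close>

lemma W_covariance: "expectation (\<lambda>\<omega>. W s \<omega> * W t \<omega>) = (nu s + nu t - nu (s - t)) / 2"
proof -
  have i: "integrable M (\<lambda>\<omega>. W s \<omega> * W t \<omega>)" for s t
    by (intro lin_span_integrable_mult lin_span_W)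
  have "nu (s - t) = expectation (\<lambda>\<omega>. W s \<omega> * W s \<omega> + W t \<omega> * W t \<omega> - 2 * (W s \<omega> * W t \<omega>))"
    unfolding W_diff_square[symmetric]
    by (intro Bochner_Integration.integral_cong) (auto simp: power2_eq_square algebra_simps)
  also have "\<dots> = nu s + nu t - 2 * expectation (\<lambda>\<omega>. W s \<omega> * W t \<omega>)"
    using i W_square[of s] W_square[of t] by (simp add: power2_eq_square)
  finally show ?thesis by simp
qed

text \<open>In the expanded product all values of \<open>nu\<close> at \<open>t\<close>,
  \<open>t + r\<close> and \<open>t + s\<close> cancel, which leaves the covariance formula for
  \<open>r\<close> and \<open>s\<close>.\<close>

lemma increment_covariance:
  "expectation (\<lambda>\<omega>. (W (t + r) \<omega> - W t \<omega>) * (W (t + s) \<omega> - W t \<omega>)) = expectation (\<lambda>\<omega>. W r \<omega> * W s \<omega>)"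
proof -
  have i: "integrable M (\<lambda>\<omega>. W s \<omega> * W t \<omega>)" for s t
    by (intro lin_span_integrable_mult lin_span_W)
  have "expectation (\<lambda>\<omega>. (W (t + r) \<omega> - W t \<omega>) * (W (t + s) \<omega> - W t \<omega>))
      = expectation (\<lambda>\<omega>. W (t + r) \<omega> * W (t + s) \<omega> - W (t + r) \<omega> * W t \<omega> - W t \<omega> * W (t + s) \<omega> + W t \<omega> * W t \<omega>)"
    by (intro Bochner_Integration.integral_cong) (auto simp: algebra_simps)
  then show ?thesis using i by (simp add: W_covariance field_simps)
qed

lemma expectation_sum_square:
  assumes "finite F" "\<And>s. s \<in> F \<Longrightarrow> X s \<in> lin_span"
  shows "expectation (\<lambda>\<omega>. (\<Sum>s\<in>F. c s * X s \<omega>)\<^sup>2)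
    = (\<Sum>r\<in>F. \<Sum>s\<in>F. c r * c s * expectation (\<lambda>\<omega>. X r \<omega> * X s \<omega>))"
proof -
  have i: "r \<in> F \<Longrightarrow> s \<in> F \<Longrightarrow> integrable M (\<lambda>\<omega>. X r \<omega> * X s \<omega>)" for r s
    using assms by (intro lin_span_integrable_mult) auto
  have "expectation (\<lambda>\<omega>. (\<Sum>s\<in>F. c s * X s \<omega>)\<^sup>2)
      = expectation (\<lambda>\<omega>. \<Sum>r\<in>F. \<Sum>s\<in>F. (c r * c s) * (X r \<omega> * X s \<omega>))"
    by (intro Bochner_Integration.integral_cong) (auto simp: power2_eq_square sum_product mult_ac)
  also have "\<dots> = (\<Sum>r\<in>F. \<Sum>s\<in>F. c r * c s * expectation (\<lambda>\<omega>. X r \<omega> * X s \<omega>))"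
    using i by simp
  finally show ?thesis .
qed

lemma increment_sum_square:
  assumes "finite F"
  shows "expectation (\<lambda>\<omega>. (\<Sum>s\<in>F. c s * (W (t + s) \<omega> - W t \<omega>))\<^sup>2) = expectation (\<lambda>\<omega>. (\<Sum>s\<in>F. c s * W s \<omega>)\<^sup>2)"
  using assms by (simp add: expectation_sum_square lin_span_W lin_span_diff increment_covariance)

abbreviation Z :: "real \<Rightarrow> 'a \<Rightarrow> real" where "Z \<equiv> fbm_Z H W"

text \<open>The deterministic term is the mean of the increment \<open>W (t + s) - W t\<close> under the density \<open>Z t\<close>.
  It is chosen so that \<open>Z\<close> built from \<open>recentred t\<close> is \<open>s \<mapsto> Z (t + s) / Z t\<close>.\<close>

definition recentred :: "real \<Rightarrow> real \<Rightarrow> 'a \<Rightarrow> real" where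
  "recentred t s \<omega> = W (t + s) \<omega> - W t \<omega> - (nu (t + s) - nu t - nu s) / 2"

lemma recentred_measurable [measurable]: "recentred t s \<in> borel_measurable M"
  unfolding recentred_def[abs_def] by measurable

lemma Z_measurable [measurable]: "Z t \<in> borel_measurable M"
  unfolding fbm_Z_def[abs_def] by measurable

lemma nn_integral_Z: "(\<integral>\<^sup>+\<omega>. ennreal (Z t \<omega>) \<partial>M) = 1"
proof -
  have "(\<integral>\<^sup>+\<omega>. ennreal (Z t \<omega>) \<partial>M) = (\<integral>\<^sup>+\<omega>. ennreal (exp (- nu t / 2)) * ennreal (exp (W t \<omega>)) \<partial>M)"
    by (simp add: fbm_Z_def ennreal_mult[symmetric] exp_add[symmetric])
  also have "\<dots> = ennreal (exp (- nu t / 2)) * ennreal (exp (nu t / 2))"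
    using centered_gaussian_rv_exp[OF prob_space_axioms lin_span_gaussian[OF lin_span_W], of t]
    by (simp add: nn_integral_cmult W_square)
  finally show ?thesis by (simp add: ennreal_mult[symmetric] exp_add[symmetric])
qed

text \<open>The tilt contributes the phase \<open>m\<close>, the covariance of \<open>W t\<close>
  with \<open>L\<close>, and recentring subtracts exactly this. What remains depends only on the
  variance of \<open>L\<close>, and stationarity of increments replaces it by that of the
  combination of the \<open>W s\<close>.\<close>

lemma tilted_recentred_iexp:
  assumes F: "finite F"
  shows "(\<integral>\<omega>. Z t \<omega> *\<^sub>R iexp (\<Sum>s\<in>F. c s * recentred t s \<omega>) \<partial>M) = (\<integral>\<omega>. iexp (\<Sum>s\<in>F. c s * W s \<omega>) \<partial>M)"
proof -
  define L where "L = (\<lambda>\<omega>. \<Sum>s\<in>F. c s * (W (t + s) \<omega> - W t \<omega>))"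
  define m where "m = (\<Sum>s\<in>F. c s * ((nu (t + s) - nu t - nu s) / 2))"
  have L_span: "L \<in> lin_span"
    unfolding L_def using F by (intro lin_span_sum lin_span_scale lin_span_diff lin_span_W)
  have i: "integrable M (\<lambda>\<omega>. W s \<omega> * W t \<omega>)" for s t
    by (intro lin_span_integrable_mult lin_span_W)
  have "expectation (\<lambda>\<omega>. W t \<omega> * L \<omega>) = expectation (\<lambda>\<omega>. \<Sum>s\<in>F. c s * (W t \<omega> * W (t + s) \<omega> - W t \<omega> * W t \<omega>))"
    unfolding L_def by (intro Bochner_Integration.integral_cong) (auto simp: sum_distrib_left algebra_simps)
  also have "\<dots> = m"
    using i by (simp add: W_covariance m_def field_simps)
  finally have cov: "expectation (\<lambda>\<omega>. W t \<omega> * L \<omega>) = m" .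
  have "(\<integral>\<omega>. Z t \<omega> *\<^sub>R iexp (\<Sum>s\<in>F. c s * recentred t s \<omega>) \<partial>M) = (\<integral>\<omega>. iexp (- m) * (Z t \<omega> *\<^sub>R iexp (L \<omega>)) \<partial>M)"
  proof (intro Bochner_Integration.integral_cong refl)
    fix \<omega>
    have "(\<Sum>s\<in>F. c s * recentred t s \<omega>) = - m + L \<omega>"
      by (simp add: recentred_def L_def m_def right_diff_distrib sum_subtractf)
    then show "Z t \<omega> *\<^sub>R iexp (\<Sum>s\<in>F. c s * recentred t s \<omega>) = iexp (- m) * (Z t \<omega> *\<^sub>R iexp (L \<omega>))"
      by (simp only: of_real_add distrib_left exp_add) simp
  qed
  also have "\<dots> = iexp (- m) * (\<integral>\<omega>. exp (W t \<omega> - expectation (\<lambda>\<omega>. (W t \<omega>)\<^sup>2) / 2) *\<^sub>R iexp (L \<omega>) \<partial>M)"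
    unfolding integral_mult_right_zero W_square fbm_Z_def ..
  also have "\<dots> = iexp (- m) * (iexp m * exp (- expectation (\<lambda>\<omega>. (L \<omega>)\<^sup>2) / 2))"
    using gaussian_pair_tilted_iexp[OF prob_space_axioms, of "W t" L] cov
    by (simp add: lin_span_gaussian lin_span_add lin_span_scale lin_span_W L_span)
  also have "\<dots> = complex_of_real (exp (- expectation (\<lambda>\<omega>. (L \<omega>)\<^sup>2) / 2))"
    unfolding mult.assoc[symmetric] exp_add[symmetric] by simp
  also have "\<dots> = (\<integral>\<omega>. iexp (1 * (\<Sum>s\<in>F. c s * W s \<omega>)) \<partial>M)"
    unfolding L_def increment_sum_square[OF F]
    by (subst centered_gaussian_rv_iexp) (auto intro!: lin_span_gaussian lin_span_sum lin_span_scale lin_span_W F)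
  finally show ?thesis by simp
qed

lemma distr_recentred:
  "distr (density M (\<lambda>\<omega>. ennreal (Z t \<omega>))) (Pi\<^sub>M UNIV (\<lambda>_. borel)) (\<lambda>\<omega> s. recentred t s \<omega>)
    = distr M (Pi\<^sub>M UNIV (\<lambda>_. borel)) (\<lambda>\<omega> s. W s \<omega>)"
proof (rule distr_PiM_eqI_char)
  show "finite_measure (density M (\<lambda>\<omega>. ennreal (Z t \<omega>)))"
    by (rule finite_measureI) (simp add: emeasure_density nn_integral_Z cong: nn_integral_cong)
  show "finite_measure M" by unfold_locales
  fix F :: "real set" and c :: "real \<Rightarrow> real"
  assume "finite F"
  then show "(\<integral>\<omega>. iexp (\<Sum>s\<in>F. c s * recentred t s \<omega>) \<partial>density M (\<lambda>\<omega>. ennreal (Z t \<omega>))) = (\<integral>\<omega>. iexp (\<Sum>s\<in>F. c s * W s \<omega>) \<partial>M)"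
    by (subst integral_density) (auto simp: fbm_Z_def[of H W t] tilted_recentred_iexp[of F t c, unfolded fbm_Z_def] simp del: of_real_sum of_real_mult)
qed auto

end

section \<open>Almost sure integrability of the likelihood\<close>

lemma integrable_inverse_one_plus_square: "integrable lborel (\<lambda>x::real. inverse (1 + x\<^sup>2))"
  using integrable_inverse_1_plus_square by (simp add: set_integrable_def)

lemma bounded_of_suminf_ennreal_finite:
  fixes f :: "nat \<Rightarrow> real"
  assumes "(\<Sum>n. ennreal (f n)) \<noteq> \<infinity>"
  shows "\<exists>C. \<forall>n. f n \<le> C"
proof -
  define S where "S = (\<Sum>n. ennreal (f n))"
  obtain C where C: "C \<ge> 0" "S = ennreal C"
    using assms unfolding S_def[symmetric] by (cases S) auto
  have "ennreal (f n) \<le> S" for n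
    unfolding S_def using sum_le_suminf[of "\<lambda>n. ennreal (f n)" "{n}"] by simp
  then have "f n \<le> C" for n
    using C by simp
  then show ?thesis by blast
qed

context fbm
begin

lemma W_jointly_measurable: "(\<lambda>p. W (snd p) (fst p)) \<in> borel_measurable (M \<Otimes>\<^sub>M borel)"
proof -
  have "(\<lambda>p. path_eval (snd p) (\<lambda>s. W s (fst p))) \<in> borel_measurable (M \<Otimes>\<^sub>M borel)"
    by (rule path_eval_measurable) measurable
  then show ?thesis
    by (rule measurable_cong[THEN iffD1, rotated])
      (auto simp: space_pair_measure path_eval_continuous W_continuous)
qed

text \<open>Halving the exponent breaks the balance that keeps the mean of \<open>Z t\<close> at
  one: \<open>W t / 2\<close> has variance \<open>nu t / 4\<close>, giving exp(nu t / 8) against the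
  deterministic factor exp(- nu t / 4).\<close>

lemma nn_integral_sqrt_Z: "(\<integral>\<^sup>+\<omega>. ennreal (sqrt (Z t \<omega>)) \<partial>M) = ennreal (exp (- nu t / 8))"
proof -
  have g: "centered_gaussian_rv M (\<lambda>\<omega>. (1 / 2) * W t \<omega>)"
    by (intro lin_span_gaussian lin_span_scale lin_span_W)
  have v: "expectation (\<lambda>\<omega>. ((1 / 2) * W t \<omega>)\<^sup>2) = nu t / 4"
    by (simp add: power_mult_distrib power_divide W_square)
  have sq: "sqrt (Z t \<omega>) = exp (- nu t / 4) * exp ((1 / 2) * W t \<omega>)" for \<omega>
  proof (rule real_sqrt_unique)
    show "(exp (- nu t / 4) * exp ((1 / 2) * W t \<omega>))\<^sup>2 = Z t \<omega>"
      unfolding fbm_Z_def exp_add[symmetric] exp_double[symmetric] by (simp add: field_simps)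
  qed simp
  have "(\<integral>\<^sup>+\<omega>. ennreal (sqrt (Z t \<omega>)) \<partial>M) = (\<integral>\<^sup>+\<omega>. ennreal (exp (- nu t / 4)) * ennreal (exp ((1 / 2) * W t \<omega>)) \<partial>M)"
    unfolding sq by (simp add: ennreal_mult)
  also have "\<dots> = ennreal (exp (- nu t / 4)) * ennreal (exp (nu t / 8))"
    using centered_gaussian_rv_exp[OF prob_space_axioms g] unfolding v
    by (simp add: nn_integral_cmult)
  also have "\<dots> = ennreal (exp (- nu t / 8))"
    by (simp add: ennreal_mult[symmetric] exp_add[symmetric])
  finally show ?thesis .
qed

text \<open>A stretched exponential beats every power. The square is chosen because undoing the
  square root of \<open>Z\<close> later turns it into a fourth power.\<close>

lemma summable_poly_exp_nu: "summable (\<lambda>n. (2 + real n)\<^sup>2 * exp (- nu (real n) / 8))"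
proof (rule summable_comparison_test_bigo)
  show "summable (\<lambda>n. norm (inverse (real n ^ 2)))"
    using inverse_power_summable[of 2, where 'a=real] by simp
  show "(\<lambda>n. (2 + real n)\<^sup>2 * exp (- nu (real n) / 8)) \<in> O(\<lambda>n. inverse (real n ^ 2))"
    using H_pos by (simp, real_asymp)
qed

text \<open>A series with finite mean is almost surely finite, so its terms are bounded. The sign
  \<epsilon> covers the nonnegative and the nonpositive integers.\<close>

lemma AE_sqrt_Z_bounded:
  assumes \<epsilon>: "\<bar>\<epsilon>\<bar> = (1::real)"
  shows "AE \<omega> in M. \<exists>C. \<forall>n. (2 + real n)\<^sup>2 * sqrt (Z (\<epsilon> * real n) \<omega>) \<le> C"
proof -
  let ?f = "\<lambda>n \<omega>. ennreal ((2 + real n)\<^sup>2 * sqrt (Z (\<epsilon> * real n) \<omega>))"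
  have "(\<integral>\<^sup>+\<omega>. (\<Sum>n. ?f n \<omega>) \<partial>M) = (\<Sum>n. \<integral>\<^sup>+\<omega>. ?f n \<omega> \<partial>M)"
    by (rule nn_integral_suminf) measurable
  also have "\<dots> = (\<Sum>n. ennreal ((2 + real n)\<^sup>2 * exp (- nu (real n) / 8)))"
    using \<epsilon> by (intro arg_cong[where f=suminf] ext)
      (simp add: ennreal_mult nn_integral_cmult nn_integral_sqrt_Z abs_mult)
  also have "\<dots> \<noteq> \<infinity>"
    unfolding infinity_ennreal_def by (rule ennreal_suminf_neq_top[OF summable_poly_exp_nu]) simp
  finally have "AE \<omega> in M. (\<Sum>n. ?f n \<omega>) \<noteq> \<infinity>"
    by (intro nn_integral_PInf_AE) auto
  then show ?thesis
    by eventually_elim (rule bounded_of_suminf_ennreal_finite)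
qed

text \<open>Rounding goes towards 0, not downwards, so that \<open>nu (base t) \<le> nu t\<close>:
  replacing the deterministic term of \<open>Z t\<close> by the one at \<open>base t\<close> can
  then only enlarge the value.\<close>

definition base :: "real \<Rightarrow> int" where
  "base t = (if t \<ge> 0 then \<lfloor>t\<rfloor> else \<lceil>t\<rceil>)"

lemma base_le: "\<bar>of_int (base t)\<bar> \<le> \<bar>t\<bar>" "\<bar>t\<bar> \<le> \<bar>of_int (base t)\<bar> + 1" "\<bar>t - of_int (base t)\<bar> \<le> 1"
  unfolding base_def by (auto split: if_splits; linarith)+

lemma base_measurable [measurable]: "base \<in> measurable borel (count_space UNIV)"
  unfolding base_def[abs_def] by measurable

lemma base_increment_jointly_measurable:
  "(\<lambda>p. exp (W (snd p) (fst p) - W (of_int (base (snd p))) (fst p))) \<in> borel_measurable (M \<Otimes>\<^sub>M borel)"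
proof -
  have [measurable]: "(\<lambda>p. W (of_int (base (snd p))) (fst p)) \<in> borel_measurable (M \<Otimes>\<^sub>M borel)"
    by (rule measurable_compose_countable[where f="\<lambda>k p. W (of_int k) (fst p)" and g="\<lambda>p. base (snd p)"]) measurable
  note [measurable] = W_jointly_measurable
  show ?thesis by measurable
qed

text \<open>Tonelli: as \<open>t\<close> is within distance one of \<open>base t\<close>, the
  increment has variance at most one and its exponential has mean at most exp(1/2). A uniform bound
  is not integrable over the line, hence the weight 1/(1 + t^2).\<close>

lemma AE_base_increment_finite:
  "AE \<omega> in M. (\<integral>\<^sup>+t. ennreal (inverse (1 + t\<^sup>2) * exp (W t \<omega> - W (of_int (base t)) \<omega>)) \<partial>lborel) \<noteq> \<infinity>"
proof -
  interpret P: pair_sigma_finite M lborel ..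
  let ?f = "\<lambda>\<omega> t. ennreal (inverse (1 + t\<^sup>2) * exp (W t \<omega> - W (of_int (base t)) \<omega>))"
  note [measurable] = base_increment_jointly_measurable
  have "(\<lambda>p. ?f (fst p) (snd p)) \<in> borel_measurable (M \<Otimes>\<^sub>M borel)"
    by measurable
  then have m[measurable]: "case_prod ?f \<in> borel_measurable (M \<Otimes>\<^sub>M lborel)"
    by (simp add: case_prod_beta' cong: measurable_cong_sets sets_pair_measure_cong)
  have "(\<integral>\<^sup>+\<omega>. (\<integral>\<^sup>+t. ?f \<omega> t \<partial>lborel) \<partial>M) = (\<integral>\<^sup>+t. (\<integral>\<^sup>+\<omega>. ?f \<omega> t \<partial>M) \<partial>lborel)"
    by (rule P.Fubini'[symmetric]) (rule m)
  also have "\<dots> \<le> (\<integral>\<^sup>+t. ennreal (inverse (1 + t\<^sup>2) * exp (1 / 2)) \<partial>lborel)"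
  proof (rule nn_integral_mono)
    fix t :: real
    let ?X = "\<lambda>\<omega>. W t \<omega> - W (of_int (base t)) \<omega>"
    have g: "centered_gaussian_rv M ?X" by (intro lin_span_gaussian lin_span_diff lin_span_W)
    have "nu (t - of_int (base t)) \<le> 1 powr (2 * H)"
      using base_le(3)[of t] H_pos by (intro powr_mono2) auto
    then have "(\<integral>\<^sup>+\<omega>. ennreal (exp (?X \<omega>)) \<partial>M) \<le> ennreal (exp (1 / 2))"
      unfolding centered_gaussian_rv_exp[OF prob_space_axioms g] W_diff_square by (intro ennreal_leI) simp
    then have "ennreal (inverse (1 + t\<^sup>2)) * (\<integral>\<^sup>+\<omega>. ennreal (exp (?X \<omega>)) \<partial>M) \<le> ennreal (inverse (1 + t\<^sup>2)) * ennreal (exp (1 / 2))"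
      by (rule mult_left_mono) simp
    then show "(\<integral>\<^sup>+\<omega>. ?f \<omega> t \<partial>M) \<le> ennreal (inverse (1 + t\<^sup>2) * exp (1 / 2))"
      by (simp add: ennreal_mult nn_integral_cmult)
  qed
  also have "\<dots> < \<infinity>"
    using integrable_mult_left[OF integrable_inverse_one_plus_square, of "exp (1 / 2)"]
    by (simp add: nn_integral_eq_integral)
  finally have fin: "(\<integral>\<^sup>+\<omega>. (\<integral>\<^sup>+t. ?f \<omega> t \<partial>lborel) \<partial>M) \<noteq> \<infinity>" by simp
  show ?thesis
    by (rule nn_integral_PInf_AE[OF _ fin]) (rule lborel.borel_measurable_nn_integral[OF m])
qed

lemma nu_mono: "\<bar>s\<bar> \<le> \<bar>t\<bar> \<Longrightarrow> nu s \<le> nu t"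
  using H_pos by (intro powr_mono2) auto

lemma nu_continuous: "continuous_on UNIV (\<lambda>t. nu t)"
  using H_pos by (intro continuous_on_powr' continuous_intros) auto

lemma Z_continuous:
  assumes "\<omega> \<in> space M"
  shows "continuous_on UNIV (\<lambda>t. Z t \<omega>)"
  unfolding fbm_Z_def using W_continuous[OF assms] H_pos
  by (auto intro!: continuous_intros nu_continuous)

text \<open>The mean of \<open>\<integral> Z\<close> is infinite. Writing \<open>Z t\<close> as \<open>Z k\<close> times an increment, with \<open>k\<close> the integer
  next to \<open>t\<close> towards \<open>0\<close>, the decay comes from \<open>E (sqrt (Z k)) = exp (- nu k / 8)\<close>, while the
  increments have bounded exponential moments.\<close>

lemma AE_weighted_Z_integrable: "AE \<omega> in M. integrable lborel (\<lambda>t. (1 + \<bar>t\<bar>) * Z t \<omega>)"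
  using AE_sqrt_Z_bounded[of 1, simplified] AE_sqrt_Z_bounded[of "-1", simplified] AE_base_increment_finite AE_space
proof eventually_elim
  case (elim \<omega>)
  then obtain C1 C2 where C1: "\<And>n. (2 + real n)\<^sup>2 * sqrt (Z (real n) \<omega>) \<le> C1"
    and C2: "\<And>n. (2 + real n)\<^sup>2 * sqrt (Z (- real n) \<omega>) \<le> C2"
    by auto
  define C where "C = max C1 C2"
  have C: "(2 + \<bar>of_int k\<bar>)\<^sup>2 * sqrt (Z (of_int k) \<omega>) \<le> C" for k
    using C1[of "nat k"] C2[of "nat (- k)"] by (cases "k \<ge> 0") (auto simp: C_def)
  let ?e = "\<lambda>t. inverse (1 + t\<^sup>2) * exp (W t \<omega> - W (of_int (base t)) \<omega>)"
  have bound: "(1 + \<bar>t\<bar>) * Z t \<omega> \<le> C\<^sup>2 * ?e t" for t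
  proof -
    define k where "k = (of_int (base t) :: real)"
    define a where "a = 1 + \<bar>t\<bar>"
    \<comment> \<open>The inequality \<open>a \<le> 2 + \<bar>k\<bar>\<close> is where the 2 in the
      polynomial weight comes from: rounding loses at most one.\<close>
    have a: "a \<ge> 1" "a \<le> 2 + \<bar>k\<bar>" using base_le(2)[of t] by (auto simp: a_def k_def)
    have "((2 + \<bar>k\<bar>)\<^sup>2 * sqrt (Z k \<omega>))\<^sup>2 \<le> C\<^sup>2"
      unfolding k_def by (rule power_mono[OF C]) (simp add: fbm_Z_def)
    then have "(2 + \<bar>k\<bar>) ^ 4 * Z k \<omega> \<le> C\<^sup>2"
      by (simp add: power_mult_distrib fbm_Z_def flip: power_mult)
    moreover have "a ^ 4 * Z k \<omega> \<le> (2 + \<bar>k\<bar>) ^ 4 * Z k \<omega>"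
      using a by (intro mult_right_mono power_mono) (auto simp: fbm_Z_def)
    ultimately have Zk: "a ^ 4 * Z k \<omega> \<le> C\<^sup>2" by linarith
    have "Z t \<omega> \<le> Z k \<omega> * exp (W t \<omega> - W k \<omega>)"
      unfolding fbm_Z_def exp_add[symmetric] using nu_mono[OF base_le(1)[of t]] by (simp add: k_def)
    then have "a ^ 4 * Z t \<omega> \<le> a ^ 4 * (Z k \<omega> * exp (W t \<omega> - W k \<omega>))"
      using a by (intro mult_left_mono) auto
    also have "\<dots> \<le> C\<^sup>2 * exp (W t \<omega> - W k \<omega>)"
      unfolding mult.assoc[symmetric] by (intro mult_right_mono Zk) simp
    finally have A: "a ^ 4 * Z t \<omega> \<le> C\<^sup>2 * exp (W t \<omega> - W k \<omega>)" .
    \<comment> \<open>Of the four available powers of \<open>a\<close>, one is the factor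
      \<open>1 + \<bar>t\<bar>\<close> of the claim and the other three dominate
      \<open>1 + t\<^sup>2\<close>, which pays for the weight on the increments.\<close>
    have "1 + t\<^sup>2 \<le> a\<^sup>2" by (simp add: a_def power2_eq_square algebra_simps)
    also have "a\<^sup>2 \<le> a ^ 3" using a by (intro power_increasing) auto
    finally have "(1 + t\<^sup>2) * (a * Z t \<omega>) \<le> a ^ 3 * (a * Z t \<omega>)"
      using a by (intro mult_right_mono) (auto simp: fbm_Z_def)
    also have "\<dots> = a ^ 4 * Z t \<omega>" by (simp add: power3_eq_cube power4_eq_xxxx mult_ac)
    also note A
    finally have "(1 + t\<^sup>2) * (a * Z t \<omega>) \<le> C\<^sup>2 * exp (W t \<omega> - W k \<omega>)" .
    moreover have "0 < 1 + t\<^sup>2" by (simp add: add_pos_nonneg)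
    ultimately show ?thesis by (simp add: a_def k_def field_simps)
  qed
  have mZ[measurable]: "(\<lambda>t. Z t \<omega>) \<in> borel_measurable borel"
    by (rule borel_measurable_continuous_onI) (rule Z_continuous[OF elim(4)])
  have me[measurable]: "?e \<in> borel_measurable borel"
    using measurable_compose[OF measurable_Pair1'[OF elim(4)] base_increment_jointly_measurable] by simp
  show ?case
  proof (rule integrableI_nonneg)
    show "(\<lambda>t. (1 + \<bar>t\<bar>) * Z t \<omega>) \<in> borel_measurable lborel" by measurable
    have "(\<integral>\<^sup>+t. ennreal ((1 + \<bar>t\<bar>) * Z t \<omega>) \<partial>lborel) \<le> (\<integral>\<^sup>+t. ennreal (C\<^sup>2) * ennreal (?e t) \<partial>lborel)"
      using bound by (intro nn_integral_mono) (simp add: ennreal_mult[symmetric] ennreal_leI)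
    also have "\<dots> = ennreal (C\<^sup>2) * (\<integral>\<^sup>+t. ennreal (?e t) \<partial>lborel)"
      by (rule nn_integral_cmult) measurable
    also have "\<dots> < \<infinity>"
      using elim(3) by (simp add: ennreal_mult_less_top less_top)
    finally show "(\<integral>\<^sup>+t. ennreal ((1 + \<bar>t\<bar>) * Z t \<omega>) \<partial>lborel) < \<infinity>" .
  qed simp
qed

end

section \<open>The shift identity\<close>

lemma integral_shift:
  fixes f :: "real \<Rightarrow> real"
  shows "(\<integral>s. f (t + s) \<partial>lborel) = (\<integral>s. f s \<partial>lborel)"
  using lborel_integral_real_affine[of 1 f t] by simp

context fbm
begin

lemma AE_Z_integrable:
  "AE \<omega> in M. integrable lborel (\<lambda>t. Z t \<omega>) \<and> integrable lborel (\<lambda>t. t * Z t \<omega>)"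
  using AE_weighted_Z_integrable AE_space
proof eventually_elim
  case (elim \<omega>)
  have [measurable]: "(\<lambda>t. Z t \<omega>) \<in> borel_measurable borel"
    by (rule borel_measurable_continuous_onI) (rule Z_continuous[OF elim(2)])
  have "integrable lborel (\<lambda>t. Z t \<omega>)"
    by (rule Bochner_Integration.integrable_bound[OF elim(1)]) (auto simp: distrib_right)
  moreover have "integrable lborel (\<lambda>t. t * Z t \<omega>)"
    by (rule Bochner_Integration.integrable_bound[OF elim(1)]) (auto simp: distrib_right abs_mult)
  ultimately show ?case ..
qed

lemma integral_Z_pos:
  assumes "integrable lborel (\<lambda>t. Z t \<omega>)"
  shows "0 < (\<integral>t. Z t \<omega> \<partial>lborel)"
proof -
  have "(\<integral>t. Z t \<omega> \<partial>lborel) \<noteq> 0"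
  proof
    assume "(\<integral>t. Z t \<omega> \<partial>lborel) = 0"
    then have "AE t in lborel. Z t \<omega> = 0"
      using integral_nonneg_eq_0_iff_AE[OF assms] by simp
    then have "AE t in (lborel :: real measure). False"
      by eventually_elim (use fbm_Z_pos[of H W _ \<omega>] in \<open>simp add: less_le\<close>)
    then show False by (simp add: eventually_False ae_filter_eq_bot_iff)
  qed
  moreover have "0 \<le> (\<integral>t. Z t \<omega> \<partial>lborel)" by simp
  ultimately show ?thesis by linarith
qed

lemma integral_q:
  assumes "integrable lborel (\<lambda>t. Z t \<omega>)"
  shows "integrable lborel (\<lambda>t. fbm_q H W t \<omega>)" "(\<integral>t. fbm_q H W t \<omega> \<partial>lborel) = 1"
  using assms integral_Z_pos[OF assms] by (simp_all add: fbm_q_def)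

lemma q_nonneg: "0 \<le> fbm_q H W t \<omega>"
  by (simp add: fbm_q_def)

section \<open>Effect of recentring on \<open>Z\<close>, \<open>q\<close> and
  \<open>zeta\<close>\<close>

lemma fbm_Z_recentred: "fbm_Z H (recentred t) s \<omega> = Z (t + s) \<omega> / Z t \<omega>"
  unfolding fbm_Z_def recentred_def exp_diff[symmetric]
  by (rule arg_cong[where f=exp]) (simp add: field_simps)

text \<open>The factor \<open>Z t\<close> cancels between numerator and normalisation, and
  translation does not change the integral over the line. Both facts survive for a divergent
  integral, whose value defaults to 0 on either side.\<close>

lemma fbm_q_recentred: "fbm_q H (recentred t) s \<omega> = fbm_q H W (t + s) \<omega>"
proof -
  have "(\<integral>u. fbm_Z H (recentred t) u \<omega> \<partial>lborel) = (\<integral>u. Z u \<omega> \<partial>lborel) / Z t \<omega>"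
    unfolding fbm_Z_recentred using integral_shift[of "\<lambda>u. Z u \<omega>" t] by simp
  then show ?thesis
    unfolding fbm_q_def fbm_Z_recentred using fbm_Z_pos[of H W t \<omega>] by (simp add: less_le)
qed

text \<open>The barycentre of a translated probability density moves by the translation.
  Integrability is needed to split the integral of \<open>(s - t) * q s\<close> and to have total
  mass one.\<close>

lemma fbm_zeta_recentred:
  assumes "integrable lborel (\<lambda>t. Z t \<omega>)" "integrable lborel (\<lambda>t. t * Z t \<omega>)"
  shows "fbm_zeta H (recentred t) \<omega> = fbm_zeta H W \<omega> - t"
proof -
  have i: "integrable lborel (\<lambda>s. s * fbm_q H W s \<omega>)"
    using assms(2) by (simp add: fbm_q_def)
  have "fbm_zeta H (recentred t) \<omega> = (\<integral>s. (t + s - t) * fbm_q H W (t + s) \<omega> \<partial>lborel)"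
    by (simp add: fbm_zeta_def fbm_q_recentred)
  also have "\<dots> = (\<integral>s. (s - t) * fbm_q H W s \<omega> \<partial>lborel)"
    by (rule integral_shift)
  also have "\<dots> = fbm_zeta H W \<omega> - t"
    using i integral_q[OF assms(1)] by (simp add: fbm_zeta_def left_diff_distrib)
  finally show ?thesis .
qed

lemma recentred_continuous:
  assumes "\<omega> \<in> space M"
  shows "continuous_on UNIV (\<lambda>s. recentred t s \<omega>)"
proof -
  have "continuous_on UNIV (\<lambda>s. W (t + s) \<omega>)"
    by (rule continuous_on_compose2[OF W_continuous[OF assms], of UNIV "\<lambda>s. t + s"]) (auto intro!: continuous_intros)
  moreover have "continuous_on UNIV (\<lambda>s. nu (t + s))"
    by (rule continuous_on_compose2[OF nu_continuous, of UNIV "\<lambda>s. t + s"]) (auto intro!: continuous_intros)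
  ultimately show ?thesis
    unfolding recentred_def by (intro continuous_on_diff continuous_on_divide continuous_on_const nu_continuous) auto
qed

lemma shift_identity:
  assumes G[measurable]: "G \<in> borel_measurable borel"
  shows "(\<integral>\<omega>. G (fbm_zeta H W \<omega> - t) * fbm_q H W t \<omega> \<partial>M) = (\<integral>\<omega>. G (fbm_zeta H W \<omega>) * fbm_q H W (- t) \<omega> \<partial>M)"
proof -
  let ?P = "Pi\<^sub>M UNIV (\<lambda>_. borel) :: (real \<Rightarrow> real) measure"
  \<comment> \<open>Here \<open>path_eval\<close> plays the role of the process, with the path
    \<open>x\<close> as sample point. This makes \<open>\<Phi>\<close> measurable on the product
    space, and on continuous paths it takes the intended value.\<close>
  define \<Phi> where "\<Phi> x = G (fbm_zeta H path_eval x) * fbm_q H path_eval (- t) x" for x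
  have "(\<lambda>p. path_eval (snd p) (\<lambda>s. (fst p) s)) \<in> borel_measurable (?P \<Otimes>\<^sub>M borel)"
    by (rule path_eval_measurable[of "\<lambda>s x. x s"]) measurable
  then have pe: "(\<lambda>p. path_eval (snd p) (fst p)) \<in> borel_measurable (?P \<Otimes>\<^sub>M borel)" by simp
  note [measurable] = fbm_zeta_measurable[OF pe, of H] measurable_section[OF fbm_q_measurable[OF pe], of H "- t"]
  have [measurable]: "\<Phi> \<in> borel_measurable ?P" unfolding \<Phi>_def by measurable
  have \<Phi>: "\<Phi> (\<lambda>s. X s \<omega>) = G (fbm_zeta H X \<omega>) * fbm_q H X (- t) \<omega>"
    if "continuous_on UNIV (\<lambda>s. X s \<omega>)" for X \<omega>
    using path_eval_continuous[OF that]
    by (simp add: \<Phi>_def fbm_zeta_def fbm_q_def fbm_Z_def)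
  have [measurable]: "(\<lambda>\<omega> s. recentred t s \<omega>) \<in> measurable M ?P" "(\<lambda>\<omega> s. W s \<omega>) \<in> measurable M ?P"
    by (auto intro!: measurable_PiM_single')
  note [measurable] = fbm_zeta_measurable[OF W_jointly_measurable, of H]
    measurable_section[OF fbm_q_measurable[OF W_jointly_measurable, of H]]
  have "(\<integral>\<omega>. G (fbm_zeta H W \<omega> - t) * fbm_q H W t \<omega> \<partial>M) = (\<integral>\<omega>. Z t \<omega> *\<^sub>R \<Phi> (\<lambda>s. recentred t s \<omega>) \<partial>M)"
  proof (rule integral_cong_AE)
    show "AE \<omega> in M. G (fbm_zeta H W \<omega> - t) * fbm_q H W t \<omega> = Z t \<omega> *\<^sub>R \<Phi> (\<lambda>s. recentred t s \<omega>)"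
      using AE_Z_integrable AE_space
    proof eventually_elim
      case (elim \<omega>)
      \<comment> \<open>Since \<open>Z 0 = 1\<close>, the value \<open>q 0\<close> is the reciprocal
        of the normalising integral.\<close>
      have "Z t \<omega> * fbm_q H W 0 \<omega> = fbm_q H W t \<omega>"
        using W_0[OF elim(2)] by (simp add: fbm_q_def fbm_Z_def[of H W 0])
      then show ?case
        using elim by (simp add: \<Phi> recentred_continuous fbm_zeta_recentred fbm_q_recentred mult.left_commute)
    qed
  qed measurable
  also have "\<dots> = (\<integral>x. \<Phi> x \<partial>distr (density M (\<lambda>\<omega>. ennreal (Z t \<omega>))) ?P (\<lambda>\<omega> s. recentred t s \<omega>))"
    by (subst integral_distr) (auto simp: integral_density)
  also have "\<dots> = (\<integral>\<omega>. \<Phi> (\<lambda>s. W s \<omega>) \<partial>M)"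
    unfolding distr_recentred by (subst integral_distr) auto
  also have "\<dots> = (\<integral>\<omega>. G (fbm_zeta H W \<omega>) * fbm_q H W (- t) \<omega> \<partial>M)"
    by (intro Bochner_Integration.integral_cong) (auto simp: \<Phi> W_continuous)
  finally show ?thesis .
qed

text \<open>For almost every path the reflected density \<open>q (- t)\<close> has mass one in
  \<open>t\<close>. Hence the integral of the absolute value over \<open>t\<close> is
  \<open>\<bar>G zeta\<bar>\<close>, bounded by \<open>B\<close>, which justifies the exchange; the
  same fact evaluates the inner integral.\<close>

lemma integral_fubini_q:
  assumes G[measurable]: "G \<in> borel_measurable borel" and B: "\<And>x. \<bar>G x\<bar> \<le> B"
  shows "(\<integral>t. (\<integral>\<omega>. G (fbm_zeta H W \<omega>) * fbm_q H W (- t) \<omega> \<partial>M) \<partial>lborel) = expectation (\<lambda>\<omega>. G (fbm_zeta H W \<omega>))"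
proof -
  interpret P: pair_sigma_finite M lborel ..
  let ?f = "\<lambda>\<omega> t. G (fbm_zeta H W \<omega>) * fbm_q H W (- t) \<omega>"
  note zm[measurable] = fbm_zeta_measurable[OF W_jointly_measurable, of H]
  have q[measurable]: "(\<lambda>p. fbm_q H W (- snd p) (fst p)) \<in> borel_measurable (M \<Otimes>\<^sub>M borel)"
    using measurable_compose[OF _ fbm_q_measurable[OF W_jointly_measurable, of H], of "\<lambda>p. (fst p, - snd p)" "M \<Otimes>\<^sub>M borel"] by simp
  have "(\<lambda>p. ?f (fst p) (snd p)) \<in> borel_measurable (M \<Otimes>\<^sub>M borel)" by measurable
  then have m[measurable]: "case_prod ?f \<in> borel_measurable (M \<Otimes>\<^sub>M lborel)"
    by (simp add: case_prod_beta' cong: measurable_cong_sets sets_pair_measure_cong)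
  have refl_q: "integrable lborel (\<lambda>t. fbm_q H W (- t) \<omega>)" "(\<integral>t. fbm_q H W (- t) \<omega> \<partial>lborel) = 1"
    if "integrable lborel (\<lambda>t. Z t \<omega>)" for \<omega>
    using integral_q[OF that] lborel_integrable_real_affine[of "\<lambda>t. fbm_q H W t \<omega>" "-1" 0]
      lborel_integral_real_affine[of "-1" "\<lambda>t. fbm_q H W t \<omega>" 0] by simp_all
  have "integrable (M \<Otimes>\<^sub>M lborel) (case_prod ?f)"
  proof (rule P.Fubini_integrable[OF m])
    show "AE \<omega> in M. integrable lborel (\<lambda>t. case_prod ?f (\<omega>, t))"
      using AE_Z_integrable by eventually_elim (simp add: refl_q)
    have "AE \<omega> in M. (\<integral>t. norm (case_prod ?f (\<omega>, t)) \<partial>lborel) = \<bar>G (fbm_zeta H W \<omega>)\<bar>"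
      using AE_Z_integrable by eventually_elim (simp add: refl_q abs_mult q_nonneg)
    moreover have "integrable M (\<lambda>\<omega>. \<bar>G (fbm_zeta H W \<omega>)\<bar>)"
      using B by (auto intro!: integrable_const_bound[where B=B])
    ultimately show "integrable M (\<lambda>\<omega>. \<integral>t. norm (case_prod ?f (\<omega>, t)) \<partial>lborel)"
      by (subst integrable_cong_AE) auto
  qed
  from P.Fubini_integral[OF this]
  have "(\<integral>t. (\<integral>\<omega>. ?f \<omega> t \<partial>M) \<partial>lborel) = (\<integral>\<omega>. (\<integral>t. ?f \<omega> t \<partial>lborel) \<partial>M)" .
  also have "\<dots> = expectation (\<lambda>\<omega>. G (fbm_zeta H W \<omega>))"
  proof (rule integral_cong_AE)
    show "AE \<omega> in M. (\<integral>t. ?f \<omega> t \<partial>lborel) = G (fbm_zeta H W \<omega>)"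
      using AE_Z_integrable by eventually_elim (simp add: refl_q)
  qed measurable
  finally show ?thesis .
qed

end

theorem theorem2:
  fixes M :: "'a measure" and H :: real and W :: "real \<Rightarrow> 'a \<Rightarrow> real"
    and G :: "real \<Rightarrow> real"
  assumes "prob_space M"
    and "0 < H" and "H \<le> 1"
    and "two_sided_fbm M H W"
    and "G \<in> borel_measurable borel"
    and "\<exists>B. \<forall>x. \<bar>G x\<bar> \<le> B"
  shows "(\<integral>\<omega>. G (fbm_zeta H W \<omega>) \<partial>M) =
         (\<integral>t. (\<integral>\<omega>. G (fbm_zeta H W \<omega> - t) * fbm_q H W t \<omega> \<partial>M) \<partial>lborel)"
proof -
  interpret fbm M H W
    using assms(1,2,4) by (simp add: fbm_def fbm_axioms_def)
  obtain B where B: "\<And>x. \<bar>G x\<bar> \<le> B" using assms(6) by auto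
  show ?thesis
    unfolding shift_identity[OF assms(5)] by (rule integral_fubini_q[OF assms(5) B, symmetric])
qed

end
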